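(* Let $i\in\mathbb{N}_0$ and let $\alpha,\beta\in\mathbb{C}$. Then $$F^{1:1;3}_{1:0;2}\left[\begin{matrix}\alpha: & \tfrac32\beta-\tfrac12\alpha-1-i\,; & \tfrac{\alpha-\beta}{2}+1+i,\ 1+\tfrac12\alpha,\ \tfrac{\alpha-\beta}{2}\,;\\ \beta: & -\,; & \tfrac12\alpha,\ 1+\tfrac{\alpha+\beta}{2}\,;\end{matrix}\ \tfrac12,\ \tfrac12\right] =\frac{2^{\alpha-1}\,\Gamma\!\left(\frac12\beta-\frac12\alpha-i\right)\Gamma\!\left(1+\frac{\alpha+\beta}{2}\right)}{\Gamma\!\left(\frac12\beta-\frac12\alpha\right)\Gamma(1+\alpha)}\sum_{r=0}^{i}(-1)^r\binom{i}{r}\frac{\Gamma\!\left(\frac{\alpha+r+1}{2}\right)}{\Gamma\!\left(\frac{\beta+r+1}{2}-i\right)}$$ and $$F^{1:1;3}_{1:0;2}\left[\begin{matrix}\alpha: & \tfrac32\beta-\tfrac12\alpha-1+i\,; & \tfrac{\alpha-\beta}{2}+1-i,\ 1+\tfrac12\alpha,\ \tfrac{\alpha-\beta}{2}\,;\\ \beta: & -\,; & \tfrac12\alpha,\ 1+\tfrac{\alpha+\beta}{2}\,;\end{matrix}\ \tfrac12,\ \tfrac12\right] =\frac{2^{\alpha-1}\,\Gamma\!\left(1+\frac{\alpha+\beta}{2}\right)}{\Gamma(1+\alpha)}\sum_{r=0}^{i}\binom{i}{r}\frac{\Gamma\!\left(\frac{\alpha+r+1}{2}\right)}{\Gamma\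!\left(\frac{\beta+r+1}{2}\right)}.$$
   Context: For $\lambda\in\mathbb{C}$ and $n\in\mathbb{N}_0$, $(\lambda)_0=1$ and $(\lambda)_n=\lambda(\lambda+1)\cdots(\lambda+n-1)$; $\Gamma$ is Euler's Gamma function and $\binom{i}{r}$ the binomial coefficient. The (generalized) Kampé de Fériet function is defined by $$F^{H:A;B}_{G:C;D}\left[\begin{matrix}(h_H): & (a_A)\,; & (b_B)\,;\\ (g_G): & (c_C)\,; & (d_D)\,;\end{matrix}\ x,\ y\right]=\sum_{m=0}^\infty\sum_{n=0}^\infty\frac{\prod_{j=1}^H(h_j)_{m+n}\prod_{j=1}^A(a_j)_m\prod_{j=1}^B(b_j)_n}{\prod_{j=1}^G(g_j)_{m+n}\prod_{j=1}^C(c_j)_m\prod_{j=1}^D(d_j)_n}\frac{x^m}{m!}\frac{y^n}{n!},$$ where a dash "$-$" denotes an empty list of parameters (empty products equal $1$). Parameters are tacitly assumed to be such that the double series converges, no denominator parameter is a non-positive integer, and all Gamma values appearing are finite. *)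

theory Defs
  imports "HOL-Analysis.Analysis"
begin

text \<open>General term of the Kampe de Feriet double series
  F^{H:A;B}_{G:C;D}[(h):(a);(b); (g):(c);(d); x, y].
  Parameter lists: hs (numerator, index m+n), as (numerator, index m),
  bs (numerator, index n), gs (denominator, index m+n), cs (denominator, index m),
  ds (denominator, index n). An empty list stands for a dash.\<close>
definition kdf_term ::
  "complex list \<Rightarrow> complex list \<Rightarrow> complex list \<Rightarrow>
   complex list \<Rightarrow> complex list \<Rightarrow> complex list \<Rightarrow>
   complex \<Rightarrow> complex \<Rightarrow> nat \<times> nat \<Rightarrow> complex" where
  "kdf_term hs as bs gs cs ds x y = (\<lambda>(m, n).
     (prod_list (map (\<lambda>h. pochhammer h (m + n)) hs)
      * prod_list (map (\<lambda>a. pochhammer a m) as)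
      * prod_list (map (\<lambda>b. pochhammer b n) bs))
     / (prod_list (map (\<lambda>g. pochhammer g (m + n)) gs)
      * prod_list (map (\<lambda>c. pochhammer c m) cs)
      * prod_list (map (\<lambda>d. pochhammer d n) ds))
     * (x ^ m / of_nat (fact m)) * (y ^ n / of_nat (fact n)))"

text \<open>The Kampe de Feriet function: the (unordered, hence absolutely convergent
  in the complex numbers) sum of the double series over all pairs (m,n).\<close>
definition kdf ::
  "complex list \<Rightarrow> complex list \<Rightarrow> complex list \<Rightarrow>
   complex list \<Rightarrow> complex list \<Rightarrow> complex list \<Rightarrow>
   complex \<Rightarrow> complex \<Rightarrow> complex" where
  "kdf hs as bs gs cs ds x y = infsum (kdf_term hs as bs gs cs ds x y) UNIV"

end

theory Submission
  imports Defs
begin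

text \<open>
  Write \<open>\<gamma> = (\<alpha> - \<beta>)/2 + 1 \<plusminus> i\<close> and \<open>d = 1 + (\<alpha> + \<beta>)/2\<close>; the parameter of index \<open>m\<close> is then \<open>\<beta> - \<gamma>\<close>.
  Two applications of the Chu--Vandermonde identity evaluate the sum of the terms with \<open>m + n = N\<close>:
  it is \<open>2\<^sup>-\<^sup>N (h N - h (N - 1))\<close> with \<open>h N = (1+\<alpha>)\<^sub>N (d-\<gamma>)\<^sub>N / ((d)\<^sub>N N!)\<close>. Hence the double series equals
  half of \<open>\<^sub>2F\<^sub>1(1+\<alpha>, d-\<gamma>; d; 1/2)\<close>, where \<open>d - \<gamma> = \<beta> \<minusplus> i\<close>. For \<open>i = 0\<close> this is Gauss' second
  summation theorem; it follows by Euler's transformation from Bailey's theorem for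
  \<open>\<^sub>2F\<^sub>1(p, 1-p; c; 1/2)\<close>, which in turn holds because both sides satisfy the same first-order
  recurrence under \<open>c \<mapsto> c + 2\<close> and have the same behaviour as \<open>c \<rightarrow> \<infinity>\<close>. General \<open>i\<close> is reached
  by contiguous relations, which match Pascal's rule in the binomial sums.
\<close>

section \<open>Finite hypergeometric identities\<close>

text \<open>Reflecting \<open>(c+k)_(n-k)\<close> into \<open>(-1)^(n-k) (1-c-n)_(n-k)\<close>
  merges the signs into \<open>(-1)^n\<close> and leaves the Chu-Vandermonde convolution. The
  quotient-free form makes sense in any commutative ring and for every \<open>c\<close>.\<close>

lemma pochhammer_alternating_Vandermonde:
  fixes b c :: "'a :: comm_ring_1"
  shows "(\<Sum>k\<le>n. of_nat (n choose k) * (-1)^k * pochhammer b k * pochhammer (c + of_nat k) (n - k))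
           = pochhammer (c - b) n"
proof -
  have reflect: "pochhammer (c + of_nat k) (n - k)
                   = (-1)^(n - k) * pochhammer (1 - c - of_nat n) (n - k)" if "k \<le> n" for k
    using pochhammer_minus'[of "c + of_nat n - 1" "n - k"] that by (simp add: algebra_simps of_nat_diff)
  have "(\<Sum>k\<le>n. of_nat (n choose k) * (-1)^k * pochhammer b k * pochhammer (c + of_nat k) (n - k))
      = (\<Sum>k\<le>n. (-1)^n * (of_nat (n choose k) * pochhammer b k * pochhammer (1 - c - of_nat n) (n - k)))"
  proof (rule sum.cong[OF refl])
    fix k assume "k \<in> {..n}"
    hence k: "k \<le> n" by simp
    have sgn: "(-1 :: 'a)^n = (-1)^k * (-1)^(n - k)"
      using k by (simp flip: power_add)
    show "of_nat (n choose k) * (-1)^k * pochhammer b k * pochhammer (c + of_nat k) (n - k)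
      = (-1)^n * (of_nat (n choose k) * pochhammer b k * pochhammer (1 - c - of_nat n) (n - k))"
      unfolding reflect[OF k] sgn by (simp only: mult_ac)
  qed
  also have "\<dots> = (-1)^n * pochhammer (b + (1 - c - of_nat n)) n"
    by (simp only: pochhammer_binomial_sum sum_distrib_left)
  also have "\<dots> = pochhammer (c - b) n"
    using pochhammer_minus'[of "c + of_nat n - 1 - b" n] by (simp add: algebra_simps)
  finally show ?thesis .
qed

text \<open>Chu-Vandermonde as the value of \<open>2F1(-n, b; d; 1)\<close>: splitting
  \<open>(d)_n = (d)_k (d+k)_(n-k)\<close> clears the denominators and leads back to
  \<open>pochhammer_alternating_Vandermonde\<close>.\<close>

lemma alternating_binomial_pochhammer_ratio:
  fixes b d :: "'a :: field"
  assumes "pochhammer d n \<noteq> 0"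
  shows "(\<Sum>k\<le>n. of_nat (n choose k) * (-1)^k * (pochhammer b k / pochhammer d k))
           = pochhammer (d - b) n / pochhammer d n"
proof -
  have "of_nat (n choose k) * (-1)^k * (pochhammer b k / pochhammer d k) =
        of_nat (n choose k) * (-1)^k * pochhammer b k * pochhammer (d + of_nat k) (n - k) / pochhammer d n"
    if "k \<in> {..n}" for k
  proof -
    have eq: "pochhammer d n = pochhammer d k * pochhammer (d + of_nat k) (n - k)"
      using that by (intro pochhammer_product) simp
    moreover have "pochhammer (d + of_nat k) (n - k) \<noteq> 0"
      using assms eq by auto
    ultimately show ?thesis by simp
  qed
  thus ?thesis
    by (simp flip: pochhammer_alternating_Vandermonde[of n b d] add: sum_divide_distrib)
qed

text \<open>The weight \<open>k\<close> is absorbed by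
  \<open>k * binomial(m+1, k) = (m+1) * binomial(m, k-1)\<close>, which gives a Chu-Vandermonde sum
  with \<open>b + 1\<close> and \<open>d + 1\<close>. The difference \<open>d - b\<close> is
  unchanged, so \<open>(d-b)_m\<close> factors out of both contributions. In the double series such
  a weight comes from \<open>(1 + \<alpha>/2)_n / (\<alpha>/2)_n = 1 + 2n/\<alpha>\<close>.\<close>

lemma alternating_binomial_pochhammer_ratio_linear:
  fixes b d l :: "'a :: field"
  assumes "pochhammer d (Suc m) \<noteq> 0"
  shows "(\<Sum>k\<le>Suc m. of_nat (Suc m choose k) * (-1)^k * ((1 + l * of_nat k) * pochhammer b k / pochhammer d k))
           = pochhammer (d - b) m * (d - b + of_nat m - l * of_nat (Suc m) * b) / pochhammer d (Suc m)"
proof -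
  have d: "d \<noteq> 0" "pochhammer (d + 1) m \<noteq> 0"
    using assms by (auto simp: pochhammer_rec)
  have "(\<Sum>k\<le>Suc m. of_nat (Suc m choose k) * (-1)^k * (of_nat k * pochhammer b k / pochhammer d k))
      = (\<Sum>k\<le>m. of_nat (Suc m choose Suc k) * (-1)^Suc k * (of_nat (Suc k) * pochhammer b (Suc k) / pochhammer d (Suc k)))"
    by (subst sum.atMost_Suc_shift) simp
  also have "\<dots> = (\<Sum>k\<le>m. - (of_nat (Suc m) * b / d)
                * (of_nat (m choose k) * (-1)^k * (pochhammer (b + 1) k / pochhammer (d + 1) k)))"
  proof (rule sum.cong[OF refl])
    fix k
    have "of_nat (Suc m choose Suc k) * of_nat (Suc k) = (of_nat (Suc m) * of_nat (m choose k) :: 'a)"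
      using Suc_times_binomial[of k m] by (metis mult.commute of_nat_mult)
    moreover have "of_nat (Suc m choose Suc k) * (-1)^Suc k * (of_nat (Suc k) * pochhammer b (Suc k) / pochhammer d (Suc k))
      = (of_nat (Suc m choose Suc k) * of_nat (Suc k)) * (-1)^Suc k * (pochhammer b (Suc k) / pochhammer d (Suc k))"
      by (simp only: mult_ac times_divide_eq_right)
    ultimately have "of_nat (Suc m choose Suc k) * (-1)^Suc k * (of_nat (Suc k) * pochhammer b (Suc k) / pochhammer d (Suc k))
      = of_nat (Suc m) * of_nat (m choose k) * (-1)^Suc k * (pochhammer b (Suc k) / pochhammer d (Suc k))"
      by (simp only:)
    thus "of_nat (Suc m choose Suc k) * (-1)^Suc k * (of_nat (Suc k) * pochhammer b (Suc k) / pochhammer d (Suc k))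
      = - (of_nat (Suc m) * b / d) * (of_nat (m choose k) * (-1)^k * (pochhammer (b + 1) k / pochhammer (d + 1) k))"
      by (simp add: pochhammer_rec mult_ac)
  qed
  also have "\<dots> = - (of_nat (Suc m) * b / d) * (pochhammer (d - b) m / pochhammer (d + 1) m)"
    using alternating_binomial_pochhammer_ratio[OF d(2), of "b + 1"]
    by (simp only: sum_distrib_left[symmetric]) simp
  also have "\<dots> = - (of_nat (Suc m) * b * pochhammer (d - b) m / pochhammer d (Suc m))"
    by (simp add: pochhammer_rec)
  finally have weighted: "(\<Sum>k\<le>Suc m. of_nat (Suc m choose k) * (-1)^k * (of_nat k * pochhammer b k / pochhammer d k))
      = - (of_nat (Suc m) * b * pochhammer (d - b) m / pochhammer d (Suc m))" .
  have "(\<Sum>k\<le>Suc m. of_nat (Suc m choose k) * (-1)^k * ((1 + l * of_nat k) * pochhammer b k / pochhammer d k))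
      = (\<Sum>k\<le>Suc m. of_nat (Suc m choose k) * (-1)^k * (pochhammer b k / pochhammer d k))
      + l * (\<Sum>k\<le>Suc m. of_nat (Suc m choose k) * (-1)^k * (of_nat k * pochhammer b k / pochhammer d k))"
    unfolding sum_distrib_left sum.distrib[symmetric]
    by (rule sum.cong[OF refl]) (simp add: ring_distribs add_divide_distrib mult_ac)
  also have "\<dots> = pochhammer (d - b) (Suc m) / pochhammer d (Suc m)
                  + l * - (of_nat (Suc m) * b * pochhammer (d - b) m / pochhammer d (Suc m))"
    by (simp only: weighted alternating_binomial_pochhammer_ratio[OF assms])
  also have "\<dots> = pochhammer (d - b) m * (d - b + of_nat m - l * of_nat (Suc m) * b) / pochhammer d (Suc m)"
    by (simp add: pochhammer_Suc[of "d - b"] ring_distribs add_divide_distrib diff_divide_distrib mult_ac)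
  finally show ?thesis .
qed

text \<open>Coefficientwise Pfaff-Euler transformation: the left side is the coefficient of
  \<open>x^N\<close> in \<open>(1-x)^(-s)\<close> times the series with coefficients
  \<open>(g)_n c_n / n!\<close>, and on the right that series is rewritten in powers of
  \<open>-x/(1-x)\<close>. For the proof, the coefficient of each \<open>c n\<close> on the right is
  collected by exchanging the sums and evaluated by Chu-Vandermonde.\<close>

lemma pochhammer_convolution_binomial_transform:
  fixes g s :: "'a :: field_char_0" and c :: "nat \<Rightarrow> 'a"
  shows "(\<Sum>n\<le>N. pochhammer s (N - n) / fact (N - n) * (pochhammer g n / fact n) * c n)
       = (\<Sum>M\<le>N. (-1)^M * (pochhammer (g + s + of_nat M) (N - M) / fact (N - M)) * (pochhammer g M / fact M)
                  * (\<Sum>n\<le>M. of_nat (M choose n) * (-1)^n * c n))"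
proof -
  define T where "T = (\<lambda>M n. (-1)^M * (pochhammer (g + s + of_nat M) (N - M) / fact (N - M))
                        * (pochhammer g M / fact M) * (of_nat (M choose n) * (-1)^n))"
  \<comment> \<open>With \<open>M = n + k\<close> this is the alternating Vandermonde sum with
    parameters \<open>g + n\<close> and \<open>g + n + s\<close>, whose difference is
    \<open>s\<close>.\<close>
  have inner: "(\<Sum>M\<in>{M\<in>{..N}. n \<le> M}. T M n) = pochhammer s (N - n) / fact (N - n) * (pochhammer g n / fact n)"
    if "n \<in> {..N}" for n
  proof -
    have n: "n \<le> N" using that by simp
    have "(\<Sum>M\<in>{M\<in>{..N}. n \<le> M}. T M n) = (\<Sum>k\<le>N - n. T (n + k) n)"
      by (rule sum.reindex_bij_witness[of _ "\<lambda>k. n + k" "\<lambda>M. M - n"]) (use n in auto)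
    also have "\<dots> = (\<Sum>k\<le>N - n. pochhammer g n / (fact n * fact (N - n)) *
        (of_nat ((N - n) choose k) * (-1)^k * pochhammer (g + of_nat n) k
          * pochhammer (g + of_nat n + s + of_nat k) (N - n - k)))"
    proof (rule sum.cong[OF refl])
      fix k assume "k \<in> {..N - n}"
      hence k: "k \<le> N - n" by simp
      have 1: "of_nat (n + k choose n) = (fact (n + k) / (fact n * fact k) :: 'a)"
        by (simp add: binomial_fact)
      have 2: "of_nat (N - n choose k) = (fact (N - n) / (fact k * fact (N - n - k)) :: 'a)"
        using k by (simp add: binomial_fact)
      have 3: "pochhammer g (n + k) = pochhammer g n * pochhammer (g + of_nat n) k"
        by (rule pochhammer_product')
      have 4: "(-1 :: 'a)^(n + k) * (-1)^n = (-1)^k"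
        by (simp add: power_add mult_ac flip: power_mult_distrib)
      have "T (n + k) n = ((-1)^(n + k) * (-1)^n) * (pochhammer (g + of_nat n + s + of_nat k) (N - n - k) / fact (N - n - k))
               * (pochhammer g (n + k) / fact (n + k)) * of_nat (n + k choose n)"
        unfolding T_def by (simp add: add_ac)
      thus "T (n + k) n = pochhammer g n / (fact n * fact (N - n)) *
        (of_nat ((N - n) choose k) * (-1)^k * pochhammer (g + of_nat n) k
          * pochhammer (g + of_nat n + s + of_nat k) (N - n - k))"
        unfolding 1 2 3 4 by (simp add: mult_ac)
    qed
    also have "\<dots> = pochhammer g n / (fact n * fact (N - n)) * pochhammer s (N - n)"
      using pochhammer_alternating_Vandermonde[of "N - n" "g + of_nat n" "g + of_nat n + s"]
      by (simp only: sum_distrib_left[symmetric]) simp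
    finally show ?thesis by (simp add: mult_ac)
  qed
  have "(\<Sum>M\<le>N. (-1)^M * (pochhammer (g + s + of_nat M) (N - M) / fact (N - M)) * (pochhammer g M / fact M)
                  * (\<Sum>n\<le>M. of_nat (M choose n) * (-1)^n * c n))
      = (\<Sum>M\<le>N. \<Sum>n\<in>{n\<in>{..N}. n \<le> M}. T M n * c n)"
  proof (rule sum.cong[OF refl])
    fix M assume "M \<in> {..N}"
    hence "{n\<in>{..N}. n \<le> M} = {..M}" by auto
    thus "(-1)^M * (pochhammer (g + s + of_nat M) (N - M) / fact (N - M)) * (pochhammer g M / fact M)
                  * (\<Sum>n\<le>M. of_nat (M choose n) * (-1)^n * c n) = (\<Sum>n\<in>{n\<in>{..N}. n \<le> M}. T M n * c n)"
      by (simp add: T_def sum_distrib_left sum_divide_distrib mult_ac)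
  qed
  also have "\<dots> = (\<Sum>n\<le>N. \<Sum>M\<in>{M\<in>{..N}. n \<le> M}. T M n * c n)"
    by (rule sum.swap_restrict) auto
  also have "\<dots> = (\<Sum>n\<le>N. pochhammer s (N - n) / fact (N - n) * (pochhammer g n / fact n) * c n)"
    by (rule sum.cong[OF refl]) (simp only: sum_distrib_right[symmetric] inner)
  finally show ?thesis ..
qed

text \<open>This is \<open>(c)_N\<close> times the comparison of coefficients of \<open>x^N\<close>
  in Euler's transformation. The binomial transform of \<open>C\<close> is a Vandermonde sum, and
  after \<open>pochhammer_convolution_binomial_transform\<close> the remaining sum is one
  more.\<close>

lemma Pfaff_Saalschuetz:
  fixes a b c :: "'a :: field_char_0"
  shows "(\<Sum>k\<le>N. pochhammer (c - a - b) (N - k) / fact (N - k)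
                   * (pochhammer a k * pochhammer b k * pochhammer (c + of_nat k) (N - k) / fact k))
           = pochhammer (c - a) N * pochhammer (c - b) N / fact N"
proof -
  define C where "C = (\<lambda>k. pochhammer b k * pochhammer (c + of_nat k) (N - k))"
  have split: "pochhammer x N = pochhammer x M * pochhammer (x + of_nat M) (N - M)" if "M \<le> N" for x :: 'a and M
    using pochhammer_product[OF that] .
  have transf: "(\<Sum>n\<le>M. of_nat (M choose n) * (-1)^n * C n)
                  = pochhammer (c - b) M * pochhammer (c + of_nat M) (N - M)" if M: "M \<le> N" for M
  proof -
    have "C n = pochhammer b n * pochhammer (c + of_nat n) (M - n) * pochhammer (c + of_nat M) (N - M)"
      if "n \<le> M" for n
      using that M pochhammer_product[of "M - n" "N - n" "c + of_nat n"] by (simp add: C_def of_nat_diff)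
    hence "(\<Sum>n\<le>M. of_nat (M choose n) * (-1)^n * C n)
         = (\<Sum>n\<le>M. of_nat (M choose n) * (-1)^n * pochhammer b n * pochhammer (c + of_nat n) (M - n)
                     * pochhammer (c + of_nat M) (N - M))"
      by (intro sum.cong) (auto simp: mult_ac)
    also have "\<dots> = pochhammer (c - b) M * pochhammer (c + of_nat M) (N - M)"
      by (simp only: sum_distrib_right[symmetric] pochhammer_alternating_Vandermonde)
    finally show ?thesis .
  qed
  have "(\<Sum>k\<le>N. pochhammer (c - a - b) (N - k) / fact (N - k)
                   * (pochhammer a k * pochhammer b k * pochhammer (c + of_nat k) (N - k) / fact k))
      = (\<Sum>k\<le>N. pochhammer (c - a - b) (N - k) / fact (N - k) * (pochhammer a k / fact k) * C k)"
    by (simp add: C_def mult_ac)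
  also have "\<dots> = (\<Sum>M\<le>N. (-1)^M * (pochhammer (c - b + of_nat M) (N - M) / fact (N - M)) * (pochhammer a M / fact M)
                  * (\<Sum>n\<le>M. of_nat (M choose n) * (-1)^n * C n))"
  proof -
    have "a + (c - a - b) = c - b" by simp
    thus ?thesis by (subst pochhammer_convolution_binomial_transform) (simp only:)
  qed
  also have "\<dots> = (\<Sum>M\<le>N. pochhammer (c - b) N / fact N *
      (of_nat (N choose M) * (-1)^M * pochhammer a M * pochhammer (c + of_nat M) (N - M)))"
  proof (rule sum.cong[OF refl])
    fix M assume "M \<in> {..N}"
    hence M: "M \<le> N" by simp
    have "of_nat (N choose M) = (fact N / (fact M * fact (N - M)) :: 'a)"
      using M by (simp add: binomial_fact)
    thus "(-1)^M * (pochhammer (c - b + of_nat M) (N - M) / fact (N - M)) * (pochhammer a M / fact M)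
                  * (\<Sum>n\<le>M. of_nat (M choose n) * (-1)^n * C n)
        = pochhammer (c - b) N / fact N *
      (of_nat (N choose M) * (-1)^M * pochhammer a M * pochhammer (c + of_nat M) (N - M))"
      unfolding transf[OF M] split[OF M, of "c - b"] by (simp add: mult_ac)
  qed
  also have "\<dots> = pochhammer (c - b) N / fact N * pochhammer (c - a) N"
    by (simp only: sum_distrib_left[symmetric] pochhammer_alternating_Vandermonde)
  finally show ?thesis by simp
qed

text \<open>The left side is, up to powers of 2 and the factor \<open>(\<beta>)_(m+1)\<close>, the
  part of the double series with total degree \<open>m + 1\<close>. The binomial transform reduces
  it to two linearly weighted Chu-Vandermonde sums, one inside the other; the result is a difference
  of consecutive values, which makes the sum over all degrees collapse.\<close>

lemma kdf_diagonal_sum: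
  fixes \<alpha> \<beta> \<gamma> d :: "'a :: field_char_0"
  assumes "\<alpha> \<noteq> 0" and d: "\<And>n. pochhammer d n \<noteq> 0" and d_eq: "2 * d = 2 + \<alpha> + \<beta>"
  shows "pochhammer \<alpha> (Suc m) * (\<Sum>n\<le>Suc m. pochhammer (\<beta> - \<gamma>) (Suc m - n) / fact (Suc m - n)
              * (pochhammer \<gamma> n / fact n)
              * ((1 + 2 / \<alpha> * of_nat n) * pochhammer (d - 1 - \<beta>) n / pochhammer d n))
       = pochhammer \<beta> (Suc m) *
         (pochhammer (1 + \<alpha>) (Suc m) * pochhammer (d - \<gamma>) (Suc m) / (pochhammer d (Suc m) * fact (Suc m))
        - pochhammer (1 + \<alpha>) m * pochhammer (d - \<gamma>) m / (pochhammer d m * fact m))"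
proof -
  define N where "N = Suc m"
  \<comment> \<open>The inner sum has \<open>b = d - 1 - \<beta> = (\<alpha> - \<beta>)/2\<close>
    and \<open>l = 2/\<alpha>\<close>. This relation between \<open>b\<close> and
    \<open>\<alpha>\<close> makes the linear factor a multiple of \<open>\<beta>\<close>, and that
    \<open>\<beta>\<close> completes \<open>(1+\<beta>)_k\<close> to
    \<open>(\<beta>)_(k+1)\<close>.\<close>
  have transf: "(\<Sum>n\<le>M. of_nat (M choose n) * (-1)^n
                  * ((1 + 2 / \<alpha> * of_nat n) * pochhammer (d - 1 - \<beta>) n / pochhammer d n))
              = pochhammer \<beta> M * (1 + 1 / \<alpha> * of_nat M) / pochhammer d M" for M
  proof (cases M)
    case (Suc k)
    have b2: "d - 1 - \<beta> = (\<alpha> - \<beta>) / 2"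
      using d_eq by (simp add: field_simps)
    have "1 + \<beta> + of_nat k - 2 / \<alpha> * of_nat (Suc k) * (d - 1 - \<beta>) = \<beta> * (1 + 1 / \<alpha> * of_nat (Suc k))"
      unfolding b2 using \<open>\<alpha> \<noteq> 0\<close> by (simp add: field_simps)
    thus ?thesis
      unfolding Suc alternating_binomial_pochhammer_ratio_linear[OF d] by (simp add: pochhammer_rec add_ac)
  qed simp
  have "(\<Sum>n\<le>N. pochhammer (\<beta> - \<gamma>) (N - n) / fact (N - n) * (pochhammer \<gamma> n / fact n)
              * ((1 + 2 / \<alpha> * of_nat n) * pochhammer (d - 1 - \<beta>) n / pochhammer d n))
      = (\<Sum>M\<le>N. (-1)^M * (pochhammer (\<beta> + of_nat M) (N - M) / fact (N - M)) * (pochhammer \<gamma> M / fact M)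
                  * (pochhammer \<beta> M * (1 + 1 / \<alpha> * of_nat M) / pochhammer d M))"
    by (subst pochhammer_convolution_binomial_transform) (simp only: transf, simp)
  also have "\<dots> = (\<Sum>M\<le>N. pochhammer \<beta> N / fact N *
      (of_nat (N choose M) * (-1)^M * ((1 + 1 / \<alpha> * of_nat M) * pochhammer \<gamma> M / pochhammer d M)))"
  proof (rule sum.cong[OF refl])
    fix M assume "M \<in> {..N}"
    hence M: "M \<le> N" by simp
    have 1: "of_nat (N choose M) = (fact N / (fact M * fact (N - M)) :: 'a)"
      using M by (simp add: binomial_fact)
    show "(-1)^M * (pochhammer (\<beta> + of_nat M) (N - M) / fact (N - M)) * (pochhammer \<gamma> M / fact M)
                  * (pochhammer \<beta> M * (1 + 1 / \<alpha> * of_nat M) / pochhammer d M)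
       = pochhammer \<beta> N / fact N *
      (of_nat (N choose M) * (-1)^M * ((1 + 1 / \<alpha> * of_nat M) * pochhammer \<gamma> M / pochhammer d M))"
      unfolding 1 pochhammer_product[OF M, of \<beta>] by (simp add: mult_ac)
  qed
  also have "\<dots> = pochhammer \<beta> N / fact N *
      (pochhammer (d - \<gamma>) m * (d - \<gamma> + of_nat m - 1 / \<alpha> * of_nat N * \<gamma>) / pochhammer d N)"
    by (simp only: sum_distrib_left[symmetric] N_def alternating_binomial_pochhammer_ratio_linear[OF d])
  finally have S: "(\<Sum>n\<le>N. pochhammer (\<beta> - \<gamma>) (N - n) / fact (N - n) * (pochhammer \<gamma> n / fact n)
              * ((1 + 2 / \<alpha> * of_nat n) * pochhammer (d - 1 - \<beta>) n / pochhammer d n))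
     = pochhammer \<beta> N / fact N *
      (pochhammer (d - \<gamma>) m * (d - \<gamma> + of_nat m - 1 / \<alpha> * of_nat N * \<gamma>) / pochhammer d N)" .
  \<comment> \<open>Adding and subtracting \<open>N (d - \<gamma> + m)\<close> in
    \<open>\<alpha> (d - \<gamma> + m) - N \<gamma>\<close> produces two products: one extends the
    numerator symbols to index \<open>m + 1\<close>, the other cancels the last factors of
    \<open>(d)_N\<close> and \<open>N!\<close>.\<close>
  have "pochhammer \<alpha> N * (d - \<gamma> + of_nat m - 1 / \<alpha> * of_nat N * \<gamma>)
      = pochhammer (1 + \<alpha>) m * ((1 + \<alpha> + of_nat m) * (d - \<gamma> + of_nat m) - (d + of_nat m) * of_nat N)"
    using \<open>\<alpha> \<noteq> 0\<close> unfolding N_def pochhammer_rec by (simp add: field_simps)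
  hence "pochhammer \<alpha> N * (pochhammer \<beta> N / fact N *
      (pochhammer (d - \<gamma>) m * (d - \<gamma> + of_nat m - 1 / \<alpha> * of_nat N * \<gamma>) / pochhammer d N))
     = pochhammer \<beta> N * (pochhammer (1 + \<alpha>) m * pochhammer (d - \<gamma>) m *
        ((1 + \<alpha> + of_nat m) * (d - \<gamma> + of_nat m) - (d + of_nat m) * of_nat N) / (pochhammer d N * fact N))"
    by (simp add: mult_ac)
  moreover have "pochhammer (1 + \<alpha>) m * pochhammer (d - \<gamma>) m *
        ((1 + \<alpha> + of_nat m) * (d - \<gamma> + of_nat m) - (d + of_nat m) * of_nat N) / (pochhammer d N * fact N)
     = pochhammer (1 + \<alpha>) N * pochhammer (d - \<gamma>) N / (pochhammer d N * fact N)
        - pochhammer (1 + \<alpha>) m * pochhammer (d - \<gamma>) m / (pochhammer d m * fact m)"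
  proof -
    have nz: "d + of_nat m \<noteq> 0" "of_nat N \<noteq> (0 :: 'a)"
      using d[of "Suc m"] by (auto simp: pochhammer_Suc N_def simp del: of_nat_Suc)
    have den: "pochhammer d N * fact N = (pochhammer d m * fact m) * ((d + of_nat m) * of_nat N)"
      by (simp add: N_def pochhammer_Suc mult_ac del: of_nat_Suc)
    have "pochhammer (1 + \<alpha>) m * pochhammer (d - \<gamma>) m / (pochhammer d m * fact m)
        = pochhammer (1 + \<alpha>) m * pochhammer (d - \<gamma>) m * ((d + of_nat m) * of_nat N) / (pochhammer d N * fact N)"
      unfolding den using nz by simp
    moreover have "pochhammer (1 + \<alpha>) N * pochhammer (d - \<gamma>) N
        = pochhammer (1 + \<alpha>) m * pochhammer (d - \<gamma>) m * ((1 + \<alpha> + of_nat m) * (d - \<gamma> + of_nat m))"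
      unfolding N_def pochhammer_Suc by (simp only: mult_ac)
    ultimately show ?thesis
      by (simp only: right_diff_distrib diff_divide_distrib)
  qed
  ultimately show ?thesis using S unfolding N_def by (simp only:)
qed

section \<open>The regularised Gauss series\<close>

definition reg_hyp_term :: "complex \<Rightarrow> complex \<Rightarrow> complex \<Rightarrow> complex \<Rightarrow> nat \<Rightarrow> complex" where
  "reg_hyp_term a b c x n = pochhammer a n * pochhammer b n * rGamma (c + of_nat n) / fact n * x ^ n"

text \<open>The Gauss series divided by \<open>\<Gamma>(c)\<close>: this is entire in \<open>c\<close>, so that the
  contiguous relations may pass through denominator parameters in \<open>\<int>\<^sub>\<le>\<^sub>0\<close>.\<close>
definition reg_hyp :: "complex \<Rightarrow> complex \<Rightarrow> complex \<Rightarrow> complex \<Rightarrow> complex" where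
  "reg_hyp a b c x = (\<Sum>n. reg_hyp_term a b c x n)"

section \<open>Convergence of the regularised series\<close>

lemma rGamma_add_of_nat_Suc:
  fixes c :: "'a :: Gamma"
  shows "rGamma (c + of_nat n) = (c + of_nat n) * rGamma (c + of_nat (Suc n))"
  using rGamma_plus1[of "c + of_nat n"] by (simp add: add_ac)

lemma add_of_nat_over_Suc_tendsto_1: "(\<lambda>n. (a + of_nat n) / of_nat (Suc n) :: complex) \<longlonglongrightarrow> 1"
proof -
  have "(\<lambda>n. 1 + (a - 1) / of_nat (Suc n) :: complex) \<longlonglongrightarrow> 1 + 0"
    by (intro tendsto_add tendsto_const LIMSEQ_Suc[OF lim_const_over_n])
  moreover have "1 + (a - 1) / of_nat (Suc n) = (a + of_nat n) / of_nat (Suc n)" for n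
  proof -
    have "of_nat (Suc n) \<noteq> (0 :: complex)" by (simp del: of_nat_Suc)
    thus ?thesis by (simp add: field_simps)
  qed
  ultimately show ?thesis by simp
qed

text \<open>Ratio test: after dividing each linear factor by \<open>n + 1\<close>, the quotient
  \<open>R n\<close> of consecutive terms tends to \<open>x\<close>. If \<open>c\<close> is a
  non-positive integer, \<open>c + n\<close> vanishes for one \<open>n\<close>, so the quotient is
  formed only for large \<open>n\<close>.\<close>

lemma summable_norm_reg_hyp_term:
  assumes "norm x < 1"
  shows "summable (\<lambda>n. norm (reg_hyp_term a b c x n))"
proof -
  obtain r where r: "norm x < r" "r < 1"
    using dense[OF assms] by blast
  define R where "R = (\<lambda>n. ((a + of_nat n) / of_nat (Suc n)) * ((b + of_nat n) / of_nat (Suc n))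
                             / ((c + of_nat n) / of_nat (Suc n)) * x)"
  have "R \<longlonglongrightarrow> 1 * 1 / 1 * x"
    unfolding R_def by (intro tendsto_intros add_of_nat_over_Suc_tendsto_1) auto
  hence "(\<lambda>n. norm (R n)) \<longlonglongrightarrow> norm x"
    by (intro tendsto_norm) simp
  hence ev1: "eventually (\<lambda>n. norm (R n) < r) sequentially"
    using r(1) by (rule order_tendstoD)
  have ev2: "eventually (\<lambda>n. (c + of_nat n) / of_nat (Suc n) \<noteq> 0) sequentially"
    by (rule tendsto_imp_eventually_ne[OF add_of_nat_over_Suc_tendsto_1]) simp
  obtain N where N: "\<And>n. n \<ge> N \<Longrightarrow> norm (R n) < r \<and> (c + of_nat n) / of_nat (Suc n) \<noteq> 0"
    using eventually_conj[OF ev1 ev2] unfolding eventually_sequentially by blast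
  show ?thesis
  proof (rule summable_ratio_test[OF r(2), of N])
    fix n assume n: "n \<ge> N"
    have c: "c + of_nat n \<noteq> 0" and S: "of_nat (Suc n) \<noteq> (0 :: complex)"
      using N[OF n] by auto
    have "reg_hyp_term a b c x (Suc n) = R n * reg_hyp_term a b c x n"
      unfolding reg_hyp_term_def R_def rGamma_add_of_nat_Suc[of c n] pochhammer_Suc fact_Suc
      using c S by (simp add: divide_simps del: of_nat_Suc)
    thus "norm (norm (reg_hyp_term a b c x (Suc n))) \<le> r * norm (norm (reg_hyp_term a b c x n))"
      using N[OF n] by (auto simp: norm_mult intro!: mult_right_mono)
  qed
qed

lemma reg_hyp_sums: "norm x < 1 \<Longrightarrow> reg_hyp_term a b c x sums reg_hyp a b c x"
  unfolding reg_hyp_def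
  by (intro summable_sums summable_norm_cancel[OF summable_norm_reg_hyp_term])

text \<open>Termwise form of the derivative formula; the regularisation removes the usual factor
  \<open>1/c\<close>.\<close>

lemma reg_hyp_term_Suc:
  "of_nat (Suc n) * reg_hyp_term a b c x (Suc n) = a * b * x * reg_hyp_term (a + 1) (b + 1) (c + 1) x n"
proof -
  have "of_nat (Suc n) \<noteq> (0 :: complex)" by (simp del: of_nat_Suc)
  thus ?thesis
    by (simp add: reg_hyp_term_def pochhammer_rec add_ac del: of_nat_Suc) (simp add: add_ac)
qed

text \<open>The weighted terms are, up to an index shift and a constant, terms of another convergent
  Gauss series. This disposes of the boundary term when \<open>Bailey_shift\<close> is
  telescoped.\<close>

lemma of_nat_mult_reg_hyp_term_tendsto_0:
  assumes "norm x < 1"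
  shows "(\<lambda>n. of_nat n * reg_hyp_term a b c x n) \<longlonglongrightarrow> 0"
proof -
  have "reg_hyp_term (a + 1) (b + 1) (c + 1) x \<longlonglongrightarrow> 0"
    using reg_hyp_sums[OF assms] summable_LIMSEQ_zero sums_summable by blast
  hence "(\<lambda>n. a * b * x * reg_hyp_term (a + 1) (b + 1) (c + 1) x n) \<longlonglongrightarrow> 0"
    by (rule tendsto_mult_right_zero)
  hence "(\<lambda>n. of_nat (Suc n) * reg_hyp_term a b c x (Suc n)) \<longlonglongrightarrow> 0"
    by (simp only: reg_hyp_term_Suc)
  thus ?thesis by (rule LIMSEQ_imp_Suc)
qed

section \<open>Contiguous relations\<close>

text \<open>The terms of index 0 cancel, and \<open>(b+1)_(n+1) - (b)_(n+1) = (n+1) (b+1)_n\<close>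
  removes the new factor of the factorial in all later terms.\<close>

lemma reg_hyp_contiguous_numerator:
  assumes "norm x < 1"
  shows "reg_hyp a (b + 1) c x = reg_hyp a b c x + a * x * reg_hyp (a + 1) (b + 1) (c + 1) x"
proof -
  have "(\<lambda>n. reg_hyp_term a (b + 1) c x n - reg_hyp_term a b c x n) sums
          (reg_hyp a (b + 1) c x - reg_hyp a b c x)"
    by (intro sums_diff reg_hyp_sums assms)
  moreover have "(\<lambda>n. reg_hyp_term a (b + 1) c x n - reg_hyp_term a b c x n) sums
          (a * x * reg_hyp (a + 1) (b + 1) (c + 1) x)"
  proof -
    have "reg_hyp_term a (b + 1) c x (Suc n) - reg_hyp_term a b c x (Suc n)
            = a * x * reg_hyp_term (a + 1) (b + 1) (c + 1) x n" for n
    proof -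
      have S: "of_nat (Suc n) \<noteq> (0 :: complex)" by (simp del: of_nat_Suc)
      have "pochhammer (b + 1) (Suc n) - pochhammer b (Suc n) = of_nat (Suc n) * pochhammer (b + 1) n"
        unfolding pochhammer_Suc[of "b + 1"] pochhammer_rec[of b] by (simp add: algebra_simps)
      moreover have "reg_hyp_term a (b + 1) c x (Suc n) - reg_hyp_term a b c x (Suc n)
         = (pochhammer (b + 1) (Suc n) - pochhammer b (Suc n)) *
             (pochhammer a (Suc n) * rGamma (c + of_nat (Suc n)) / fact (Suc n) * x ^ Suc n)"
      proof -
        have "reg_hyp_term a y c x (Suc n) = pochhammer y (Suc n) *
             (pochhammer a (Suc n) * rGamma (c + of_nat (Suc n)) / fact (Suc n) * x ^ Suc n)" for y
          unfolding reg_hyp_term_def by (simp only: times_divide_eq_right times_divide_eq_left mult_ac)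
        thus ?thesis by (simp only: left_diff_distrib)
      qed
      ultimately show ?thesis
        using S by (simp add: reg_hyp_term_def pochhammer_rec[of a] add_ac del: of_nat_Suc) (simp add: add_ac)
    qed
    moreover have "(\<lambda>n. a * x * reg_hyp_term (a + 1) (b + 1) (c + 1) x n) sums
          (a * x * reg_hyp (a + 1) (b + 1) (c + 1) x)"
      by (intro sums_mult reg_hyp_sums assms)
    ultimately have "(\<lambda>n. reg_hyp_term a (b + 1) c x (Suc n) - reg_hyp_term a b c x (Suc n)) sums
          (a * x * reg_hyp (a + 1) (b + 1) (c + 1) x)" by simp
    thus ?thesis by (subst (asm) sums_Suc_iff) (simp add: reg_hyp_term_def)
  qed
  ultimately have "reg_hyp a (b + 1) c x - reg_hyp a b c x = a * x * reg_hyp (a + 1) (b + 1) (c + 1) x"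
    by (rule sums_unique2)
  thus ?thesis by (simp add: algebra_simps)
qed

text \<open>The combination \<open>f\<close> of terms vanishes at index 0 by the recurrence of
  \<open>rGamma\<close>, and at index \<open>n + 1\<close> it equals \<open>a x\<close> times the
  term of index \<open>n\<close> with \<open>a\<close> raised. That index shift is the source of the
  factor \<open>1 - x\<close>.\<close>

lemma reg_hyp_contiguous_denominator:
  assumes "norm x < 1"
  shows "(c - 1 - a) * reg_hyp a b c x = reg_hyp a (b - 1) (c - 1) x - a * (1 - x) * reg_hyp (a + 1) b c x"
proof -
  define f where "f = (\<lambda>n. (c - 1 - a) * reg_hyp_term a b c x n - reg_hyp_term a (b - 1) (c - 1) x n
                             + a * reg_hyp_term (a + 1) b c x n)"
  have "f sums ((c - 1 - a) * reg_hyp a b c x - reg_hyp a (b - 1) (c - 1) x + a * reg_hyp (a + 1) b c x)"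
    unfolding f_def by (intro sums_add sums_diff sums_mult reg_hyp_sums assms)
  moreover have "f sums (a * x * reg_hyp (a + 1) b c x)"
  proof -
    have "f (Suc n) = a * x * reg_hyp_term (a + 1) b c x n" for n
    proof -
      \<comment> \<open>\<open>P\<close> is the common factor of all terms involved, so that the
        claim becomes a polynomial identity in \<open>a\<close>, \<open>b\<close>, \<open>c\<close>
        and \<open>n\<close>.\<close>
      define P where "P = pochhammer (a + 1) n * pochhammer b n * rGamma (c + of_nat (Suc n)) / fact (Suc n) * x ^ Suc n"
      have S: "of_nat (Suc n) \<noteq> (0 :: complex)" by (simp del: of_nat_Suc)
      have g: "rGamma (c - 1 + of_nat (Suc n)) = (c + of_nat n) * rGamma (c + of_nat (Suc n))"
        using rGamma_add_of_nat_Suc[of c n] by simp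
      have 1: "reg_hyp_term a b c x (Suc n) = a * (b + of_nat n) * P"
        unfolding reg_hyp_term_def P_def pochhammer_rec[of a] pochhammer_Suc[of b] by (simp add: mult_ac)
      have 2: "reg_hyp_term a (b - 1) (c - 1) x (Suc n) = a * (b - 1) * (c + of_nat n) * P"
        unfolding reg_hyp_term_def P_def g pochhammer_rec[of a] pochhammer_rec[of "b - 1"] by (simp add: mult_ac)
      have 3: "reg_hyp_term (a + 1) b c x (Suc n) = (a + 1 + of_nat n) * (b + of_nat n) * P"
        unfolding reg_hyp_term_def P_def pochhammer_Suc by (simp add: mult_ac)
      have 4: "x * reg_hyp_term (a + 1) b c x n = of_nat (Suc n) * (c + of_nat n) * P"
        unfolding reg_hyp_term_def P_def rGamma_add_of_nat_Suc[of c n] fact_Suc using S by (simp add: mult_ac del: of_nat_Suc)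
      have "f (Suc n) = a * ((c - 1 - a) * (b + of_nat n) - (b - 1) * (c + of_nat n) + (a + 1 + of_nat n) * (b + of_nat n)) * P"
        unfolding f_def 1 2 3 by (simp add: algebra_simps)
      also have "\<dots> = a * (of_nat (Suc n) * (c + of_nat n)) * P"
        by (simp add: algebra_simps)
      finally show ?thesis using 4 by (simp only: mult_ac)
    qed
    moreover have "(\<lambda>n. a * x * reg_hyp_term (a + 1) b c x n) sums (a * x * reg_hyp (a + 1) b c x)"
      by (intro sums_mult reg_hyp_sums assms)
    ultimately have "(\<lambda>n. f (Suc n)) sums (a * x * reg_hyp (a + 1) b c x)" by simp
    moreover have "f 0 = 0"
      using rGamma_plus1[of "c - 1"] by (simp add: f_def reg_hyp_term_def algebra_simps)
    ultimately show ?thesis by (subst (asm) sums_Suc_iff) simp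
  qed
  ultimately have "(c - 1 - a) * reg_hyp a b c x - reg_hyp a (b - 1) (c - 1) x + a * reg_hyp (a + 1) b c x
                     = a * x * reg_hyp (a + 1) b c x"
    by (rule sums_unique2)
  thus ?thesis by (simp add: algebra_simps)
qed

section \<open>Euler's transformation\<close>

text \<open>For \<open>b = c = 1\<close> the product \<open>(1)_n rGamma(1+n)\<close> is 1, so the
  Gauss series is the binomial series and its absolute convergence is inherited.\<close>

lemma pochhammer_power_series:
  fixes s x :: complex
  assumes "norm x < 1"
  shows "summable (\<lambda>n. norm (pochhammer s n / fact n * x ^ n))"
    and "(\<lambda>n. pochhammer s n / fact n * x ^ n) sums (1 - x) powr (-s)"
proof -
  have "reg_hyp_term s 1 1 x n = pochhammer s n / fact n * x ^ n" for n
    using Gamma_fact[of n, where ?'a = complex]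
    by (simp add: reg_hyp_term_def rGamma_inverse_Gamma flip: pochhammer_fact) (simp add: field_simps)
  thus "summable (\<lambda>n. norm (pochhammer s n / fact n * x ^ n))"
    using summable_norm_reg_hyp_term[OF assms, of s 1 1] by simp
  have "((-s) gchoose n) * (-x) ^ n = pochhammer s n / fact n * x ^ n" for n
    by (simp add: gbinomial_pochhammer mult_ac flip: power_mult_distrib)
  thus "(\<lambda>n. pochhammer s n / fact n * x ^ n) sums (1 - x) powr (-s)"
    using gen_binomial_complex[of "-x" "-s"] assms by simp
qed

text \<open>Cauchy product of the Gauss series with the binomial series of exponent
  \<open>a + b - c\<close>. Writing every \<open>rGamma (c + k)\<close> as a multiple of
  \<open>rGamma (c + N)\<close> turns the coefficient of \<open>x^N\<close> into the sum of
  \<open>Pfaff_Saalschuetz\<close>.\<close>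

lemma reg_hyp_Euler:
  assumes "norm x < 1"
  shows "(1 - x) powr (a + b - c) * reg_hyp a b c x = reg_hyp (c - a) (c - b) c x"
proof -
  define s where "s = c - a - b"
  define p where "p = (\<lambda>n. pochhammer s n / fact n * x ^ n)"
  have "(\<lambda>N. \<Sum>k\<le>N. reg_hyp_term a b c x k * p (N - k)) sums ((\<Sum>n. reg_hyp_term a b c x n) * (\<Sum>n. p n))"
    unfolding p_def
    by (intro Cauchy_product_sums summable_norm_reg_hyp_term pochhammer_power_series assms)
  also have "(\<lambda>N. \<Sum>k\<le>N. reg_hyp_term a b c x k * p (N - k)) = reg_hyp_term (c - a) (c - b) c x"
  proof
    fix N
    have "reg_hyp_term a b c x k * p (N - k) = (rGamma (c + of_nat N) * x ^ N) *
        (pochhammer (c - a - b) (N - k) / fact (N - k)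
                   * (pochhammer a k * pochhammer b k * pochhammer (c + of_nat k) (N - k) / fact k))"
      if "k \<in> {..N}" for k
    proof -
      have k: "k \<le> N" using that by simp
      have 1: "rGamma (c + of_nat k) = pochhammer (c + of_nat k) (N - k) * rGamma (c + of_nat N)"
        using k pochhammer_rGamma[of "c + of_nat k" "N - k"] by (simp add: of_nat_diff)
      have 2: "x ^ N = x ^ k * x ^ (N - k)"
        using k by (simp flip: power_add)
      show ?thesis unfolding reg_hyp_term_def p_def s_def 1 2 by (simp add: mult_ac)
    qed
    hence "(\<Sum>k\<le>N. reg_hyp_term a b c x k * p (N - k)) = (rGamma (c + of_nat N) * x ^ N) *
        (pochhammer (c - a) N * pochhammer (c - b) N / fact N)"
      by (simp only: sum.cong[OF refl] sum_distrib_left[symmetric] Pfaff_Saalschuetz cong: sum.cong)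
    thus "(\<Sum>k\<le>N. reg_hyp_term a b c x k * p (N - k)) = reg_hyp_term (c - a) (c - b) c x N"
      by (simp add: reg_hyp_term_def mult_ac)
  qed
  also have "(\<Sum>n. p n) = (1 - x) powr (a + b - c)"
    using sums_unique[OF pochhammer_power_series(2)[OF assms, of s]] by (simp add: p_def s_def algebra_simps)
  finally show ?thesis
    using sums_unique by (simp add: reg_hyp_def mult.commute)
qed

section \<open>The theorems of Bailey and Gauss at one half\<close>

lemma norm_pochhammer_ge_fact:
  assumes "Re z \<ge> 1"
  shows "norm (pochhammer z n) \<ge> fact n"
proof (induction n)
  case (Suc n)
  have "1 + real n \<le> Re (z + of_nat n)" using assms by simp
  also have "\<dots> \<le> norm (z + of_nat n)" by (rule complex_Re_le_cmod)
  finally show ?case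
    using mult_mono[OF Suc.IH, of "1 + real n" "norm (z + of_nat n)"]
    by (simp add: pochhammer_Suc norm_mult mult.commute)
qed simp

text \<open>Tannery's theorem: each term with \<open>n > 0\<close> tends to 0 because
  \<open>|(z)_n| \<ge> Re z\<close> for \<open>Re z \<ge> 1\<close>, and only the constant term
  survives.\<close>

lemma hypergeometric_large_denominator_tendsto_1:
  fixes a b c x :: complex
  assumes "norm x < 1"
  shows "(\<lambda>k. \<Sum>n. pochhammer a n * pochhammer b n / (pochhammer (c + of_nat (2 * k)) n * fact n) * x ^ n) \<longlonglongrightarrow> 1"
proof -
  define t where "t = (\<lambda>n k. pochhammer a n * pochhammer b n / (pochhammer (c + of_nat (2 * k)) n * fact n) * x ^ n)"
  \<comment> \<open>The dominating series has denominator parameter 1, hence \<open>n!^2\<close>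
    below; it applies as soon as \<open>Re (c + 2k) \<ge> 1\<close>, where
    \<open>|(c+2k)_n| \<ge> n!\<close>.\<close>
  define M where "M = (\<lambda>n. norm (reg_hyp_term a b 1 x n))"
  have M: "M n = norm (pochhammer a n * pochhammer b n / (fact n * fact n) * x ^ n)" for n
    using Gamma_fact[of n, where ?'a = complex]
    by (simp add: M_def reg_hyp_term_def rGamma_inverse_Gamma field_simps norm_mult norm_divide)
  have lim: "(\<lambda>k. t n k) \<longlonglongrightarrow> (if n = 0 then 1 else 0)" for n
  proof (cases n)
    case (Suc m)
    have "filterlim (\<lambda>k. Re c + 2 * real k) at_top sequentially"
      by (intro filterlim_tendsto_add_at_top[OF tendsto_const]
            filterlim_tendsto_pos_mult_at_top[OF tendsto_const] filterlim_real_sequentially) auto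
    hence lim_inv: "(\<lambda>k. (norm (pochhammer a n * pochhammer b n / fact n * x ^ n)) / (Re c + 2 * real k)) \<longlonglongrightarrow> 0"
      by (intro tendsto_divide_0[OF tendsto_const] filterlim_at_top_imp_at_infinity)
    have "eventually (\<lambda>k. k \<ge> nat \<lceil>1 - Re c\<rceil>) sequentially"
      by (rule eventually_ge_at_top)
    hence "eventually (\<lambda>k. norm (t n k) \<le> norm (pochhammer a n * pochhammer b n / fact n * x ^ n) / (Re c + 2 * real k)) sequentially"
    proof eventually_elim
      case (elim k)
      hence Re: "Re c + 2 * real k \<ge> 1" by linarith
      define z where "z = c + of_nat (2 * k)"
      have z: "Re z = Re c + 2 * real k" by (simp add: z_def)
      have "Re z * 1 \<le> norm z * norm (pochhammer (z + 1) m)"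
        using Re z order_trans[OF fact_ge_1[of m, where ?'a = real] norm_pochhammer_ge_fact[of "z + 1" m]]
        by (intro mult_mono complex_Re_le_cmod) auto
      hence le: "Re c + 2 * real k \<le> norm (pochhammer z n)"
        by (simp add: Suc pochhammer_rec norm_mult z)
      have "t n k = pochhammer a n * pochhammer b n / fact n * x ^ n / pochhammer z n"
        by (simp add: t_def z_def mult_ac)
      hence "norm (t n k) = norm (pochhammer a n * pochhammer b n / fact n * x ^ n) / norm (pochhammer z n)"
        by (simp only: norm_divide)
      also have "\<dots> \<le> norm (pochhammer a n * pochhammer b n / fact n * x ^ n) / (Re c + 2 * real k)"
        using Re le by (intro divide_left_mono mult_pos_pos) auto
      finally show ?case .
    qed
    thus ?thesis using Suc
      by (auto intro: Lim_null_comparison[OF _ lim_inv])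
  qed (simp add: t_def)
  have bound: "eventually (\<lambda>(n, k). norm (t n k) \<le> M n) (at_top \<times>\<^sub>F sequentially)"
  proof -
    have "eventually (\<lambda>k. k \<ge> nat \<lceil>1 - Re c\<rceil>) sequentially"
      by (rule eventually_ge_at_top)
    hence "eventually (\<lambda>k. \<forall>n. norm (t n k) \<le> M n) sequentially"
    proof eventually_elim
      case (elim k)
      hence "Re (c + of_nat (2 * k)) \<ge> 1" by simp
      note ge = norm_pochhammer_ge_fact[OF this]
      show ?case
      proof
        fix n
        have pos: "norm (pochhammer (c + of_nat (2 * k)) n) > 0"
          using ge[of n] fact_gt_zero[of n, where ?'a = real] by linarith
        have "t n k = pochhammer a n * pochhammer b n / fact n * x ^ n / pochhammer (c + of_nat (2 * k)) n"
          by (simp add: t_def mult_ac)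
        hence "norm (t n k) = norm (pochhammer a n * pochhammer b n / fact n * x ^ n) / norm (pochhammer (c + of_nat (2 * k)) n)"
          by (simp only: norm_divide)
        also have "\<dots> \<le> norm (pochhammer a n * pochhammer b n / fact n * x ^ n) / fact n"
          using ge[of n] pos by (intro divide_left_mono mult_pos_pos) auto
        also have "\<dots> = M n"
          by (simp add: M norm_divide norm_mult)
        finally show "norm (t n k) \<le> M n" .
      qed
    qed
    thus ?thesis
      unfolding eventually_prod_filter
      by (intro exI[of _ "\<lambda>_. True"] exI[of _ "\<lambda>k. \<forall>n. norm (t n k) \<le> M n"]) auto
  qed
  have "summable M"
    unfolding M_def by (rule summable_norm_reg_hyp_term[OF assms])
  from tannerys_theorem[OF lim bound this] have "(\<lambda>k. \<Sum>n. t n k) \<longlonglongrightarrow> (\<Sum>n. if n = 0 then 1 else 0)"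
    by simp
  also have "(\<Sum>n. if n = 0 then 1 else 0 :: complex) = 1"
    using sums_unique[OF sums_single[of 0 "\<lambda>_. 1 :: complex"]] by simp
  finally show ?thesis by (simp add: t_def)
qed

lemma Bailey_shift:
  "reg_hyp p (1 - p) c (1/2) = (c + p) * (1 + c - p) * reg_hyp p (1 - p) (c + 2) (1/2)"
proof -
  \<comment> \<open>\<open>G\<close> is the certificate for creative telescoping of the difference of the two sides.\<close>
  define G where "G = (\<lambda>n. - 2 * (of_nat n * reg_hyp_term p (1 - p) (c + 1) (1/2) n))"
  have "G \<longlonglongrightarrow> -2 * 0"
    unfolding G_def by (intro tendsto_mult tendsto_const of_nat_mult_reg_hyp_term_tendsto_0) simp
  hence "(\<lambda>n. G (Suc n) - G n) sums 0"
    using telescope_sums[of G 0] by (simp add: G_def)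
  moreover have "(\<lambda>n. reg_hyp_term p (1 - p) c (1/2) n - (c + p) * (1 + c - p) * reg_hyp_term p (1 - p) (c + 2) (1/2) n)
                    sums (reg_hyp p (1 - p) c (1/2) - (c + p) * (1 + c - p) * reg_hyp p (1 - p) (c + 2) (1/2))"
    by (intro sums_diff sums_mult reg_hyp_sums) simp_all
  moreover have "reg_hyp_term p (1 - p) c (1/2) n - (c + p) * (1 + c - p) * reg_hyp_term p (1 - p) (c + 2) (1/2) n
                   = G (Suc n) - G n" for n
  proof -
    define Q where "Q = reg_hyp_term p (1 - p) (c + 2) (1/2) n"
    have g1: "rGamma (c + 1 + of_nat n) = (c + 1 + of_nat n) * rGamma (c + 2 + of_nat n)"
      using rGamma_add_of_nat_Suc[of "c + 1" n] by (simp add: add_ac)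
    have g0: "rGamma (c + of_nat n) = (c + of_nat n) * ((c + 1 + of_nat n) * rGamma (c + 2 + of_nat n))"
      using rGamma_add_of_nat_Suc[of c n] g1 by (simp add: add_ac)
    have 1: "reg_hyp_term p (1 - p) c (1/2) n = (c + of_nat n) * (c + 1 + of_nat n) * Q"
      unfolding Q_def reg_hyp_term_def g0 by (simp add: mult_ac)
    have 2: "G n = - 2 * of_nat n * (c + 1 + of_nat n) * Q"
      unfolding G_def Q_def reg_hyp_term_def g1 by (simp add: mult_ac)
    have S: "of_nat (Suc n) \<noteq> (0 :: complex)" by (simp del: of_nat_Suc)
    have idx: "c + 1 + of_nat (Suc n) = c + 2 + of_nat n" by simp
    \<comment> \<open>The argument \<open>1/2\<close> enters here: the new power \<open>1/2\<close>
      cancels the 2 in \<open>G\<close>, as \<open>n + 1\<close> cancels the new factor of the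
      factorial. What remains is an identity between quadratic polynomials in
      \<open>n\<close>.\<close>
    have 3: "G (Suc n) = - ((p + of_nat n) * (1 - p + of_nat n)) * Q"
      unfolding G_def Q_def reg_hyp_term_def idx pochhammer_Suc fact_Suc
      using S by (simp add: mult_ac del: of_nat_Suc)
    show ?thesis unfolding 1 2 3 Q_def[symmetric] by (simp add: algebra_simps)
  qed
  ultimately show ?thesis using sums_unique2 by fastforce
qed

lemma Bailey_shift_iterated:
  "reg_hyp p (1 - p) c (1/2) =
     4 ^ k * pochhammer ((c + p) / 2) k * pochhammer ((1 + c - p) / 2) k * reg_hyp p (1 - p) (c + of_nat (2 * k)) (1/2)"
proof (induction k)
  case (Suc k)
  have "(c + of_nat (2 * k) + p) * (1 + (c + of_nat (2 * k)) - p)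
          = 4 * (((c + p) / 2 + of_nat k) * ((1 + c - p) / 2 + of_nat k))"
    by (simp add: field_simps)
  moreover have "c + of_nat (2 * k) + 2 = c + of_nat (2 * Suc k)" by simp
  ultimately have "reg_hyp p (1 - p) (c + of_nat (2 * k)) (1/2)
     = 4 * (((c + p) / 2 + of_nat k) * ((1 + c - p) / 2 + of_nat k)) * reg_hyp p (1 - p) (c + of_nat (2 * Suc k)) (1/2)"
    using Bailey_shift[of p "c + of_nat (2 * k)"] by (simp only:)
  thus ?case using Suc.IH by (simp only: pochhammer_Suc power_Suc mult_ac)
qed simp

lemma half_notin_nonpos_Ints:
  fixes c :: complex
  assumes "c \<notin> \<int>\<^sub>\<le>\<^sub>0"
  shows "(c + of_nat r) / 2 \<notin> \<int>\<^sub>\<le>\<^sub>0"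
proof
  assume "(c + of_nat r) / 2 \<in> \<int>\<^sub>\<le>\<^sub>0"
  then obtain n where "(c + of_nat r) / 2 = - of_nat n" by (elim nonpos_Ints_cases')
  hence "c + of_nat r = - of_nat (2 * n)" by (simp add: field_simps)
  hence "c = - of_nat (2 * n + r)" by (simp add: eq_diff_eq)
  thus False using assms by (metis minus_of_nat_in_nonpos_Ints)
qed

text \<open>Iterate the shift and divide by the analogous expansion of \<open>rGamma c\<close>,
  whose Pochhammer symbol splits by duplication. The unregularised series \<open>F\<close> tends to
  1, the Pochhammer quotient tends to a quotient of values of \<open>rGamma\<close>, and Legendre's
  duplication formula brings this to the stated form. The hypothesis on \<open>c\<close> makes
  \<open>F\<close> and the division meaningful.\<close>

lemma Bailey_regular:
  assumes c: "c \<notin> \<int>\<^sub>\<le>\<^sub>0"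
  shows "reg_hyp p (1 - p) c (1/2)
           = of_real (sqrt pi) * 2 powr (1 - c) * rGamma ((c + p) / 2) * rGamma ((1 + c - p) / 2)"
proof -
  define A where "A = (c + p) / 2"
  define A' where "A' = (1 + c - p) / 2"
  define C where "C = c / 2"
  define F where "F = (\<lambda>k. \<Sum>n. pochhammer p n * pochhammer (1 - p) n / (pochhammer (c + of_nat (2 * k)) n * fact n) * (1/2) ^ n)"
  have nonpole: "C \<notin> \<int>\<^sub>\<le>\<^sub>0" "C + 1/2 \<notin> \<int>\<^sub>\<le>\<^sub>0"
    using half_notin_nonpos_Ints[OF c, of 0] half_notin_nonpos_Ints[OF c, of 1]
    by (simp_all add: C_def add_divide_distrib)
  have nz: "pochhammer C k \<noteq> 0" "pochhammer (C + 1/2) k \<noteq> 0" for k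
    using nonpole by (auto simp: pochhammer_eq_0_iff)
  have reg: "reg_hyp p (1 - p) (c + of_nat (2 * k)) (1/2) = rGamma (c + of_nat (2 * k)) * F k" for k
  proof -
    define z where "z = c + of_nat (2 * k)"
    have "z \<noteq> - of_nat j" for j
    proof
      assume "z = - of_nat j"
      hence "c = - of_nat (j + 2 * k)" by (simp add: z_def algebra_simps)
      thus False using c by (metis minus_of_nat_in_nonpos_Ints)
    qed
    hence z: "pochhammer z n \<noteq> 0" for n by (auto simp: pochhammer_eq_0_iff)
    have "reg_hyp_term p (1 - p) z (1/2)
            = (\<lambda>n. rGamma z * (pochhammer p n * pochhammer (1 - p) n / (pochhammer z n * fact n) * (1/2) ^ n))"
    proof
      fix n
      show "reg_hyp_term p (1 - p) z (1/2) n
              = rGamma z * (pochhammer p n * pochhammer (1 - p) n / (pochhammer z n * fact n) * (1/2) ^ n)"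
        unfolding pochhammer_rGamma[of z n] reg_hyp_term_def using z[of n] by (simp add: field_simps)
    qed
    with reg_hyp_sums[of "1/2" p "1 - p" z]
    have *: "(\<lambda>n. rGamma z * (pochhammer p n * pochhammer (1 - p) n / (pochhammer z n * fact n) * (1/2) ^ n))
               sums reg_hyp p (1 - p) z (1/2)"
      by simp
    have "rGamma z \<noteq> 0"
      using \<open>\<And>j. z \<noteq> - of_nat j\<close> by (auto simp: rGamma_eq_zero_iff elim!: nonpos_Ints_cases')
    hence "summable (\<lambda>n. pochhammer p n * pochhammer (1 - p) n / (pochhammer z n * fact n) * (1/2) ^ n)"
      by (rule summable_mult_D[OF sums_summable[OF *]])
    hence "(\<Sum>n. rGamma z * (pochhammer p n * pochhammer (1 - p) n / (pochhammer z n * fact n) * (1/2) ^ n)) = rGamma z * F k"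
      unfolding F_def z_def[symmetric] by (rule suminf_mult)
    thus ?thesis using sums_unique[OF *] by (simp add: z_def)
  qed
  have eq: "reg_hyp p (1 - p) c (1/2)
     = rGamma c * F (Suc k) * (rGamma_series A k * rGamma_series A' k / (rGamma_series C k * rGamma_series (C + 1/2) k))" for k
  proof -
    \<comment> \<open>\<open>rGamma_series z k\<close> contains the Pochhammer symbol of index
      \<open>k + 1\<close>, hence the offset.\<close>
    define K where "K = Suc k"
    have "rGamma c = 4 ^ K * pochhammer C K * pochhammer (C + 1/2) K * rGamma (c + of_nat (2 * K))"
      using pochhammer_rGamma[of c "2 * K"] pochhammer_double[of C K]
      by (simp add: C_def power_mult)
    moreover have "reg_hyp p (1 - p) c (1/2) = 4 ^ K * pochhammer A K * pochhammer A' K * (rGamma (c + of_nat (2 * K)) * F K)"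
      using Bailey_shift_iterated[of p c K] unfolding reg A_def A'_def .
    ultimately have "reg_hyp p (1 - p) c (1/2)
       = rGamma c * F K * (pochhammer A K * pochhammer A' K / (pochhammer C K * pochhammer (C + 1/2) K))"
      using nz[of K] by (simp add: field_simps)
    also have "pochhammer A K * pochhammer A' K / (pochhammer C K * pochhammer (C + 1/2) K)
      = rGamma_series A k * rGamma_series A' k / (rGamma_series C k * rGamma_series (C + 1/2) k)"
    proof -
      define L :: complex where "L = of_real (ln (of_nat k))"
      \<comment> \<open>Equal sums of parameters make the normalising powers of \<open>k\<close> in
        the four Gamma sequences cancel.\<close>
      have "A + A' = C + (C + 1/2)" by (simp add: A_def A'_def C_def field_simps)
      hence E: "exp (A * L) * exp (A' * L) = exp (C * L) * exp ((C + 1/2) * L)"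
        by (metis exp_add distrib_right)
      have "rGamma_series A k * rGamma_series A' k
              = pochhammer A K * pochhammer A' K / ((fact k * fact k) * (exp (A * L) * exp (A' * L)))"
        by (simp add: rGamma_series_def K_def L_def mult_ac)
      moreover have "rGamma_series C k * rGamma_series (C + 1/2) k
              = pochhammer C K * pochhammer (C + 1/2) K / ((fact k * fact k) * (exp (A * L) * exp (A' * L)))"
        unfolding E by (simp add: rGamma_series_def K_def L_def mult_ac)
      ultimately show ?thesis by simp
    qed
    finally show ?thesis by (simp only: K_def)
  qed
  have "(\<lambda>k. rGamma c * F (Suc k) * (rGamma_series A k * rGamma_series A' k / (rGamma_series C k * rGamma_series (C + 1/2) k)))
     \<longlonglongrightarrow> rGamma c * 1 * (rGamma A * rGamma A' / (rGamma C * rGamma (C + 1/2)))"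
  proof (intro tendsto_intros)
    show "(\<lambda>k. F (Suc k)) \<longlonglongrightarrow> 1"
      unfolding F_def by (rule LIMSEQ_Suc[OF hypergeometric_large_denominator_tendsto_1]) simp
  qed (use nonpole in \<open>auto simp: rGamma_eq_zero_iff\<close>)
  hence "(\<lambda>_ :: nat. reg_hyp p (1 - p) c (1/2)) \<longlonglongrightarrow> rGamma c * (rGamma A * rGamma A' / (rGamma C * rGamma (C + 1/2)))"
    by (simp only: eq[symmetric] mult_1_right)
  hence "reg_hyp p (1 - p) c (1/2) = rGamma c * (rGamma A * rGamma A' / (rGamma C * rGamma (C + 1/2)))"
    by (simp add: LIMSEQ_const_iff)
  also have "\<dots> = rGamma c * (Gamma C * Gamma (C + 1/2)) * rGamma A * rGamma A'"
    by (simp add: rGamma_inverse_Gamma field_simps)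
  also have "Gamma C * Gamma (C + 1/2) = 2 powr (1 - c) * of_real (sqrt pi) * Gamma c"
    using Gamma_legendre_duplication[OF nonpole] by (simp add: C_def powr_def Ln_of_real[of 2, simplified])
  also have "rGamma c * (2 powr (1 - c) * of_real (sqrt pi) * Gamma c) = of_real (sqrt pi) * 2 powr (1 - c)"
    using c by (simp add: rGamma_inverse_Gamma Gamma_eq_zero_iff)
  finally show ?thesis by (simp only: A_def A'_def)
qed

text \<open>Both sides obey the same recurrence under \<open>c \<mapsto> c + 2\<close>, so the
  formula is pulled back to arbitrary \<open>c\<close> from a shifted value at which
  \<open>Bailey_regular\<close> applies.\<close>

theorem Bailey_summation:
  "reg_hyp p (1 - p) c (1/2)
     = of_real (sqrt pi) * 2 powr (1 - c) * rGamma ((c + p) / 2) * rGamma ((1 + c - p) / 2)"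
proof -
  define R where "R = (\<lambda>c. of_real (sqrt pi) * 2 powr (1 - c) * rGamma ((c + p) / 2) * rGamma ((1 + c - p) / 2))"
  have R_shift: "R c = 4 ^ k * pochhammer ((c + p) / 2) k * pochhammer ((1 + c - p) / 2) k * R (c + of_nat (2 * k))" for k
  proof -
    have e: "(c + of_nat (2 * k) + p) / 2 = (c + p) / 2 + of_nat k"
            "(1 + (c + of_nat (2 * k)) - p) / 2 = (1 + c - p) / 2 + of_nat k"
      by (simp_all add: field_simps)
    have "(2 :: complex) powr (1 - c) = 2 powr (1 - (c + of_nat (2 * k)) + of_nat (2 * k))" by simp
    also have "\<dots> = 2 powr (1 - (c + of_nat (2 * k))) * 4 ^ k"
      unfolding powr_add powr_nat'[OF disjI1, of 2 "2 * k", OF zero_neq_numeral[symmetric]] by (simp add: power_mult)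
    finally show ?thesis
      unfolding R_def e pochhammer_rGamma[of "(c + p) / 2" k] pochhammer_rGamma[of "(1 + c - p) / 2" k]
      by (simp only: mult_ac)
  qed
  \<comment> \<open>This choice forces \<open>Re (c + 2k) \<ge> 1\<close>, away from the
    non-positive integers.\<close>
  define k where "k = nat \<lceil>1 - Re c\<rceil>"
  have "c + of_nat (2 * k) \<notin> \<int>\<^sub>\<le>\<^sub>0"
  proof
    assume "c + of_nat (2 * k) \<in> \<int>\<^sub>\<le>\<^sub>0"
    then obtain n where "c + of_nat (2 * k) = - of_nat n" by (elim nonpos_Ints_cases')
    hence "Re (c + of_nat (2 * k)) = - real n" by simp
    moreover have "real k \<ge> 1 - Re c" unfolding k_def by linarith
    moreover have "real k \<ge> 0" by simp
    ultimately show False by simp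
  qed
  hence "reg_hyp p (1 - p) (c + of_nat (2 * k)) (1/2) = R (c + of_nat (2 * k))"
    unfolding R_def by (rule Bailey_regular)
  thus ?thesis
    using Bailey_shift_iterated[of p c k] R_shift[of k] by (simp only: R_def)
qed

text \<open>For \<open>c = (a + b + 1)/2\<close> the parameters \<open>c - a\<close> and
  \<open>c - b\<close> add up to 1, so Euler's transformation lands in the case of Bailey's theorem
  with \<open>p = c - a\<close>. The two powers of 2 agree and cancel.\<close>

theorem Gauss_second_summation:
  "reg_hyp a b ((a + b + 1) / 2) (1/2) = of_real (sqrt pi) * rGamma ((a + 1) / 2) * rGamma ((b + 1) / 2)"
proof -
  define c where "c = (a + b + 1) / 2"
  have e: "c - b = 1 - (c - a)" "(c + (c - a)) / 2 = (b + 1) / 2" "(1 + c - (c - a)) / 2 = (a + 1) / 2"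
          "a + b - c = c - 1"
    by (simp_all add: c_def field_simps)
  have "(1/2 :: complex) powr (c - 1) = 2 powr (1 - c)"
  proof -
    have "Ln (1/2 :: complex) = - Ln 2"
      using Ln_inverse[of 2] by (simp add: inverse_eq_divide)
    thus ?thesis by (simp add: powr_def algebra_simps)
  qed
  hence "2 powr (1 - c) * reg_hyp a b c (1/2) = reg_hyp (c - a) (1 - (c - a)) c (1/2)"
    using reg_hyp_Euler[of "1/2" a b c] unfolding e by simp
  also have "\<dots> = 2 powr (1 - c) * (of_real (sqrt pi) * rGamma ((a + 1) / 2) * rGamma ((b + 1) / 2))"
    unfolding Bailey_summation e by (simp only: mult_ac)
  finally show ?thesis by (simp add: c_def)
qed

section \<open>Extensions of Gauss' theorem by integer shifts\<close>

text \<open>Pascal's rule. The parameter \<open>e\<close> is 1 for the numerator shift and -1 for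
  the denominator shift.\<close>

lemma binomial_sum_Suc:
  fixes e :: "'a :: comm_ring_1"
  shows "(\<Sum>r=0..Suc i. e ^ r * of_nat (Suc i choose r) * f r) =
         (\<Sum>r=0..i. e ^ r * of_nat (i choose r) * f r) + e * (\<Sum>r=0..i. e ^ r * of_nat (i choose r) * f (Suc r))"
proof -
  have "(\<Sum>r=0..Suc i. e ^ r * of_nat (Suc i choose r) * f r)
      = f 0 + (\<Sum>r=0..i. e ^ Suc r * of_nat (Suc i choose Suc r) * f (Suc r))"
    by (subst sum.atLeast0_atMost_Suc_shift) simp
  also have "(\<Sum>r=0..i. e ^ Suc r * of_nat (Suc i choose Suc r) * f (Suc r))
      = (\<Sum>r=0..i. e ^ Suc r * of_nat (i choose Suc r) * f (Suc r))
        + e * (\<Sum>r=0..i. e ^ r * of_nat (i choose r) * f (Suc r))"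
    unfolding sum_distrib_left sum.distrib[symmetric]
    by (rule sum.cong[OF refl]) (simp add: algebra_simps)
  also have "f 0 + ((\<Sum>r=0..i. e ^ Suc r * of_nat (i choose Suc r) * f (Suc r))
        + e * (\<Sum>r=0..i. e ^ r * of_nat (i choose r) * f (Suc r)))
      = (\<Sum>r=0..Suc i. e ^ r * of_nat (i choose r) * f r) + e * (\<Sum>r=0..i. e ^ r * of_nat (i choose r) * f (Suc r))"
    by (subst sum.atLeast0_atMost_Suc_shift) (simp add: add_ac)
  finally show ?thesis by (simp add: binomial_eq_0)
qed

lemma add_1_notin_nonpos_Ints:
  fixes a :: complex
  assumes "a \<notin> \<int>\<^sub>\<le>\<^sub>0"
  shows "a + 1 \<notin> \<int>\<^sub>\<le>\<^sub>0"
  using assms by (auto dest: plus_one_in_nonpos_Ints_imp)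

text \<open>Legendre's duplication formula solved for \<open>1/Gamma((a+1)/2)\<close>; it puts
  Gauss' theorem into the shape of the binomial sums at \<open>i = 0\<close>.\<close>

lemma rGamma_duplication:
  fixes a :: complex
  assumes a: "a \<notin> \<int>\<^sub>\<le>\<^sub>0"
  shows "of_real (sqrt pi) * rGamma ((a + 1) / 2) = 2 powr (a - 1) * rGamma a * Gamma (a / 2)"
proof -
  have np: "a / 2 \<notin> \<int>\<^sub>\<le>\<^sub>0" "a / 2 + 1/2 \<notin> \<int>\<^sub>\<le>\<^sub>0"
    using half_notin_nonpos_Ints[OF a, of 0] half_notin_nonpos_Ints[OF a, of 1]
    by (simp_all add: add_divide_distrib)
  have "Gamma (a / 2) * Gamma ((a + 1) / 2) = 2 powr (1 - a) * of_real (sqrt pi) * Gamma a"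
    using Gamma_legendre_duplication[OF np] by (simp add: powr_def Ln_of_real[of 2, simplified] add_divide_distrib)
  hence "2 powr (a - 1) * (Gamma (a / 2) * Gamma ((a + 1) / 2)) = of_real (sqrt pi) * Gamma a"
    using powr_add[of 2 "a - 1" "1 - a"] by simp
  moreover have "Gamma a \<noteq> 0" "Gamma ((a + 1) / 2) \<noteq> 0"
    using a np by (simp_all add: Gamma_eq_zero_iff add_divide_distrib)
  ultimately show ?thesis by (simp add: rGamma_inverse_Gamma field_simps)
qed

text \<open>In the contiguous relations at \<open>1/2\<close>, the coefficient \<open>a/2\<close>
  turns the prefactor belonging to \<open>a + 1\<close> back into the one belonging to
  \<open>a\<close>.\<close>

lemma powr_rGamma_shift:
  fixes a :: complex
  shows "a / 2 * (2 powr a * rGamma (a + 1)) = 2 powr (a - 1) * rGamma a"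
proof -
  have "(2 :: complex) powr a = 2 powr (a - 1) * 2"
    using powr_add[of 2 "a - 1" 1] by simp
  thus ?thesis using rGamma_plus1[of a] by (simp add: mult_ac)
qed

text \<open>Induction on \<open>i\<close> for all \<open>a\<close> and \<open>b\<close> together:
  the contiguous relation leads to the instances \<open>(a, b)\<close> and
  \<open>(a+1, b+1)\<close>. Raising both parameters replaces \<open>r\<close> by
  \<open>r + 1\<close> in the summand, so Pascal's rule joins the two sums.\<close>

theorem Gauss_second_summation_numerator_shift:
  assumes "a \<notin> \<int>\<^sub>\<le>\<^sub>0"
  shows "reg_hyp a (b + of_nat i) ((a + b + 1) / 2) (1/2)
           = 2 powr (a - 1) * rGamma a *
             (\<Sum>r=0..i. of_nat (i choose r) * (Gamma ((a + of_nat r) / 2) * rGamma ((b + of_nat r + 1) / 2)))"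
  using assms
proof (induction i arbitrary: a b)
  case 0
  thus ?case by (simp add: Gauss_second_summation rGamma_duplication)
next
  case (Suc i)
  define f where "f = (\<lambda>r. Gamma ((a + of_nat r) / 2) * rGamma ((b + of_nat r + 1) / 2))"
  have "reg_hyp a (b + of_nat i + 1) ((a + b + 1) / 2) (1/2) = reg_hyp a (b + of_nat i) ((a + b + 1) / 2) (1/2)
          + a * (1/2) * reg_hyp (a + 1) (b + of_nat i + 1) ((a + b + 1) / 2 + 1) (1/2)"
    by (rule reg_hyp_contiguous_numerator) simp
  also have "reg_hyp a (b + of_nat i) ((a + b + 1) / 2) (1/2)
          = 2 powr (a - 1) * rGamma a * (\<Sum>r=0..i. of_nat (i choose r) * f r)"
    using Suc.IH[OF Suc.prems, of b] by (simp only: f_def)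
  also have "b + of_nat i + 1 = (b + 1) + of_nat i" by simp
  also have "(a + b + 1) / 2 + 1 = ((a + 1) + (b + 1) + 1) / 2" by (simp add: field_simps)
  also have "reg_hyp (a + 1) ((b + 1) + of_nat i) (((a + 1) + (b + 1) + 1) / 2) (1/2)
          = 2 powr a * rGamma (a + 1) * (\<Sum>r=0..i. of_nat (i choose r) * f (Suc r))"
    using Suc.IH[OF add_1_notin_nonpos_Ints[OF Suc.prems], of "b + 1"] by (simp add: f_def add_ac)
  also have "2 powr (a - 1) * rGamma a * (\<Sum>r=0..i. of_nat (i choose r) * f r) + a * (1/2) *
               (2 powr a * rGamma (a + 1) * (\<Sum>r=0..i. of_nat (i choose r) * f (Suc r)))
           = 2 powr (a - 1) * rGamma a * (\<Sum>r=0..i. of_nat (i choose r) * f r)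
               + (a / 2 * (2 powr a * rGamma (a + 1))) * (\<Sum>r=0..i. of_nat (i choose r) * f (Suc r))"
    by simp
  also have "\<dots> = 2 powr (a - 1) * rGamma a * (\<Sum>r=0..Suc i. of_nat (Suc i choose r) * f r)"
    unfolding powr_rGamma_shift using binomial_sum_Suc[of 1 i f] by (simp only: power_one mult_1 distrib_left)
  finally show ?case by (simp add: f_def add_ac)
qed

text \<open>The contiguous relation leads to the instances \<open>(a, b-2)\<close> and
  \<open>(a+1, b-1)\<close> of the induction hypothesis. Both lower \<open>b - a\<close> by 2 and so
  share the prefactor \<open>E\<close>, while the coefficient \<open>c - 1 - a\<close> supplies the
  last Pochhammer factor. Keeping the product on the left avoids dividing by factors that may
  vanish.\<close>

theorem Gauss_second_summation_denominator_shift: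
  assumes "a \<notin> \<int>\<^sub>\<le>\<^sub>0"
  shows "pochhammer ((b - a + 1) / 2 - of_nat i) i * reg_hyp a (b - of_nat i) ((a + b + 1) / 2) (1/2)
           = 2 powr (a - 1) * rGamma a *
             (\<Sum>r=0..i. (-1) ^ r * of_nat (i choose r)
                * (Gamma ((a + of_nat r) / 2) * rGamma ((b + of_nat r + 1) / 2 - of_nat i)))"
  using assms
proof (induction i arbitrary: a b)
  case 0
  thus ?case by (simp add: Gauss_second_summation rGamma_duplication)
next
  case (Suc i)
  define f where "f = (\<lambda>r. Gamma ((a + of_nat r) / 2) * rGamma ((b + of_nat r + 1) / 2 - of_nat (Suc i)))"
  define E where "E = pochhammer ((b - a + 1) / 2 - of_nat (Suc i)) i"
  define c where "c = (a + b + 1) / 2"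
  have "pochhammer ((b - a + 1) / 2 - of_nat (Suc i)) (Suc i) = E * (c - 1 - a)"
    unfolding pochhammer_Suc E_def by (simp add: c_def field_simps)
  hence "pochhammer ((b - a + 1) / 2 - of_nat (Suc i)) (Suc i) * reg_hyp a (b - of_nat (Suc i)) c (1/2)
      = E * ((c - 1 - a) * reg_hyp a (b - of_nat (Suc i)) c (1/2))"
    by (simp only: mult.assoc)
  also have "(c - 1 - a) * reg_hyp a (b - of_nat (Suc i)) c (1/2)
      = reg_hyp a (b - of_nat (Suc i) - 1) (c - 1) (1/2) - a * (1 - 1/2) * reg_hyp (a + 1) (b - of_nat (Suc i)) c (1/2)"
    by (rule reg_hyp_contiguous_denominator) simp
  also have "E * \<dots> = E * reg_hyp a (b - of_nat (Suc i) - 1) (c - 1) (1/2)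
        - a / 2 * (E * reg_hyp (a + 1) (b - of_nat (Suc i)) c (1/2))"
    by (simp add: right_diff_distrib)
  also have "E * reg_hyp a (b - of_nat (Suc i) - 1) (c - 1) (1/2)
      = 2 powr (a - 1) * rGamma a * (\<Sum>r=0..i. (-1) ^ r * of_nat (i choose r) * f r)"
  proof -
    have "(b - 2 - a + 1) / 2 - of_nat i = (b - a + 1) / 2 - of_nat (Suc i)"
         "b - 2 - of_nat i = b - of_nat (Suc i) - 1" "(a + (b - 2) + 1) / 2 = c - 1"
         "\<And>r. (b - 2 + of_nat r + 1) / 2 - of_nat i = (b + of_nat r + 1) / 2 - of_nat (Suc i)"
      by (simp_all add: c_def field_simps)
    thus ?thesis using Suc.IH[OF Suc.prems, of "b - 2"] by (simp only: E_def f_def)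
  qed
  also have "E * reg_hyp (a + 1) (b - of_nat (Suc i)) c (1/2)
      = 2 powr a * rGamma (a + 1) * (\<Sum>r=0..i. (-1) ^ r * of_nat (i choose r) * f (Suc r))"
  proof -
    have "(b - 1 - (a + 1) + 1) / 2 - of_nat i = (b - a + 1) / 2 - of_nat (Suc i)"
         "b - 1 - of_nat i = b - of_nat (Suc i)" "(a + 1 + (b - 1) + 1) / 2 = c"
         "\<And>r. (b - 1 + of_nat r + 1) / 2 - of_nat i = (b + of_nat (Suc r) + 1) / 2 - of_nat (Suc i)"
         "\<And>r. (a + 1 + of_nat r) / 2 = (a + of_nat (Suc r)) / 2" "a + 1 - 1 = a"
      by (simp_all add: c_def field_simps)
    thus ?thesis
      using Suc.IH[OF add_1_notin_nonpos_Ints[OF Suc.prems], of "b - 1"] by (simp only: E_def f_def)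
  qed
  also have "2 powr (a - 1) * rGamma a * (\<Sum>r=0..i. (-1) ^ r * of_nat (i choose r) * f r)
        - a / 2 * (2 powr a * rGamma (a + 1) * (\<Sum>r=0..i. (-1) ^ r * of_nat (i choose r) * f (Suc r)))
      = 2 powr (a - 1) * rGamma a * (\<Sum>r=0..i. (-1) ^ r * of_nat (i choose r) * f r)
        - (a / 2 * (2 powr a * rGamma (a + 1))) * (\<Sum>r=0..i. (-1) ^ r * of_nat (i choose r) * f (Suc r))"
    by simp
  also have "\<dots> = 2 powr (a - 1) * rGamma a * (\<Sum>r=0..Suc i. (-1) ^ r * of_nat (Suc i choose r) * f r)"
    unfolding powr_rGamma_shift binomial_sum_Suc by (simp add: algebra_simps)
  finally show ?case by (simp only: f_def c_def)
qed

section \<open>Reduction of the double series\<close>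

text \<open>Unordered summability permits grouping by total degree, via the bijection
  \<open>(N, n) \<mapsto> (N - n, n)\<close>.\<close>

lemma summable_on_nat_pairs_sums_diagonals:
  fixes f :: "nat \<times> nat \<Rightarrow> complex"
  assumes "f summable_on UNIV"
  shows "(\<lambda>N. \<Sum>n\<le>N. f (N - n, n)) sums infsum f UNIV"
proof -
  have bij: "bij_betw (\<lambda>(N, n). (N - n, n)) (Sigma UNIV (\<lambda>N. {..N})) (UNIV :: (nat \<times> nat) set)"
    by (rule bij_betwI[of _ _ _ "\<lambda>(m, n). (m + n, n)"]) auto
  have "(f has_sum infsum f UNIV) UNIV"
    using assms by (rule has_sum_infsum)
  hence "((\<lambda>x. f ((\<lambda>(N, n). (N - n, n)) x)) has_sum infsum f UNIV) (Sigma UNIV (\<lambda>N. {..N}))"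
    by (subst has_sum_reindex_bij_betw[OF bij])
  hence "((\<lambda>N. \<Sum>n\<le>N. f (N - n, n)) has_sum infsum f UNIV) UNIV"
    by (rule has_sum_SigmaD) (auto intro: has_sum_finiteI)
  thus ?thesis by (rule has_sum_imp_sums)
qed

text \<open>The diagonal sums have the form \<open>H N - H (N-1) / 2\<close>. If the
  \<open>H N\<close> add up to \<open>S\<close>, the double series is therefore
  \<open>S - S/2\<close>.\<close>

lemma kdf_eq_reg_hyp:
  fixes \<alpha> \<beta> \<gamma> :: complex
  defines "d \<equiv> 1 + (\<alpha> + \<beta>) / 2"
  defines "T \<equiv> kdf_term [\<alpha>] [\<beta> - \<gamma>] [\<gamma>, 1 + \<alpha>/2, (\<alpha> - \<beta>)/2] [\<beta>] [] [\<alpha>/2, d] (1/2) (1/2)"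
  assumes \<beta>: "\<beta> \<notin> \<int>\<^sub>\<le>\<^sub>0" and \<alpha>: "\<alpha> / 2 \<notin> \<int>\<^sub>\<le>\<^sub>0" and d: "d \<notin> \<int>\<^sub>\<le>\<^sub>0"
    and summable: "T summable_on UNIV"
  shows "kdf [\<alpha>] [\<beta> - \<gamma>] [\<gamma>, 1 + \<alpha>/2, (\<alpha> - \<beta>)/2] [\<beta>] [] [\<alpha>/2, d] (1/2) (1/2)
           = Gamma d / 2 * reg_hyp (1 + \<alpha>) (d - \<gamma>) d (1/2)"
proof -
  have \<alpha>0: "\<alpha> \<noteq> 0" using \<alpha> by auto
  have pd: "pochhammer d n \<noteq> 0" and p\<beta>: "pochhammer \<beta> n \<noteq> 0" and p\<alpha>: "pochhammer (\<alpha>/2) n \<noteq> 0" for n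
    using d \<beta> \<alpha> by (auto simp: pochhammer_eq_0_iff)
  define c where "c = (\<lambda>n. (1 + 2 / \<alpha> * of_nat n) * pochhammer (d - 1 - \<beta>) n / pochhammer d n)"
  \<comment> \<open>This is \<open>h N\<close> of the overview with the power of the argument
    included: \<open>H N = h N / 2^N\<close>, the terms of the ordinary Gauss series.\<close>
  define H where "H = (\<lambda>N. pochhammer (1 + \<alpha>) N * pochhammer (d - \<gamma>) N / (pochhammer d N * fact N) * (1/2) ^ N)"
  define g where "g = (\<lambda>N. \<Sum>n\<le>N. T (N - n, n))"
  have T_diag: "T (N - n, n) = (1/2)^N / pochhammer \<beta> N * (pochhammer \<alpha> N *
      (pochhammer (\<beta> - \<gamma>) (N - n) / fact (N - n) * (pochhammer \<gamma> n / fact n) * c n))" if n: "n \<le> N" for N n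
  proof -
    have pow: "(1/2 :: complex) ^ N = (1/2) ^ (N - n) * (1/2) ^ n"
      using n by (simp flip: power_add)
    have "\<alpha>/2 * pochhammer (1 + \<alpha>/2) n = pochhammer (\<alpha>/2) n * (\<alpha>/2 + of_nat n)"
      using pochhammer_rec[of "\<alpha>/2" n] pochhammer_Suc[of "\<alpha>/2" n] by (simp add: add_ac)
    hence "pochhammer (1 + \<alpha>/2) n = pochhammer (\<alpha>/2) n * (1 + 2 / \<alpha> * of_nat n)"
      using \<alpha>0 by (simp add: field_simps)
    moreover have b2: "(\<alpha> - \<beta>)/2 = d - 1 - \<beta>" by (simp add: d_def field_simps)
    ultimately show ?thesis
      unfolding T_def kdf_term_def b2 pow c_def using n p\<alpha>[of n]
      by (simp add: mult_ac)
  qed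
  have g_eq: "g N = (1/2)^N / pochhammer \<beta> N * (pochhammer \<alpha> N * (\<Sum>n\<le>N.
      pochhammer (\<beta> - \<gamma>) (N - n) / fact (N - n) * (pochhammer \<gamma> n / fact n) * c n))" for N
    unfolding g_def sum_distrib_left by (intro sum.cong refl T_diag) simp
  \<comment> \<open>The factor \<open>1/2\<close> in front of \<open>H m\<close> is the part of
    \<open>2^(-m-1)\<close> that \<open>H m\<close> does not contain.\<close>
  have g_Suc: "g (Suc m) = H (Suc m) - 1/2 * H m" for m
  proof -
    have "2 * d = 2 + \<alpha> + \<beta>" by (simp add: d_def field_simps)
    from kdf_diagonal_sum[OF \<alpha>0 pd this, of m \<gamma>] show ?thesis
      unfolding g_eq c_def H_def using p\<beta>[of "Suc m"] by (simp add: right_diff_distrib mult_ac del: fact_Suc)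
  qed
  have g_0: "g 0 = H 0"
    by (simp add: g_eq H_def c_def)
  define S where "S = Gamma d * reg_hyp (1 + \<alpha>) (d - \<gamma>) d (1/2)"
  have "H N = Gamma d * reg_hyp_term (1 + \<alpha>) (d - \<gamma>) d (1/2) N" for N
  proof -
    have "Gamma d * rGamma (d + of_nat N) = 1 / pochhammer d N"
      using pochhammer_rGamma[of d N] pd[of N] d
      by (simp add: rGamma_inverse_Gamma Gamma_eq_zero_iff field_simps)
    moreover have "Gamma d * reg_hyp_term (1 + \<alpha>) (d - \<gamma>) d (1/2) N =
        pochhammer (1 + \<alpha>) N * pochhammer (d - \<gamma>) N / fact N * (1/2) ^ N * (Gamma d * rGamma (d + of_nat N))"
      by (simp add: reg_hyp_term_def mult_ac)
    ultimately show ?thesis by (simp add: H_def mult_ac)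
  qed
  hence "H = (\<lambda>N. Gamma d * reg_hyp_term (1 + \<alpha>) (d - \<gamma>) d (1/2) N)" by (rule ext)
  hence H: "H sums S"
    unfolding S_def by (simp only:) (intro sums_mult reg_hyp_sums, simp)
  have "(\<lambda>m. H (Suc m)) sums (S - H 0)"
    using H by (subst sums_Suc_iff) simp
  from sums_diff[OF this sums_mult[OF H, of "1/2"]] have "(\<lambda>m. g (Suc m)) sums (S - H 0 - 1/2 * S)"
    by (simp only: g_Suc)
  hence "g sums (S - H 0 - 1/2 * S + g 0)"
    by (simp only: sums_Suc_iff)
  hence "g sums (S / 2)" by (simp add: g_0)
  moreover have "g sums infsum T UNIV"
    unfolding g_def by (rule summable_on_nat_pairs_sums_diagonals[OF summable])
  ultimately have "infsum T UNIV = S / 2" by (rule sums_unique2[symmetric])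
  thus ?thesis by (simp add: kdf_def T_def S_def)
qed

theorem theorem7:
  fixes i :: nat and \<alpha> \<beta> :: complex
  assumes den: "\<beta> \<notin> \<int>\<^sub>\<le>\<^sub>0" "\<alpha> / 2 \<notin> \<int>\<^sub>\<le>\<^sub>0" "1 + (\<alpha> + \<beta>) / 2 \<notin> \<int>\<^sub>\<le>\<^sub>0"
  shows
   "(kdf_term [\<alpha>] [3/2*\<beta> - \<alpha>/2 - 1 - of_nat i]
        [(\<alpha> - \<beta>)/2 + 1 + of_nat i, 1 + \<alpha>/2, (\<alpha> - \<beta>)/2]
        [\<beta>] [] [\<alpha>/2, 1 + (\<alpha> + \<beta>)/2] (1/2) (1/2) summable_on UNIV
     \<and> \<beta>/2 - \<alpha>/2 - of_nat i \<notin> \<int>\<^sub>\<le>\<^sub>0 \<and> \<beta>/2 - \<alpha>/2 \<notin> \<int>\<^sub>\<le>\<^sub>0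
     \<and> 1 + \<alpha> \<notin> \<int>\<^sub>\<le>\<^sub>0
     \<and> (\<forall>r\<le>i. (\<alpha> + of_nat r + 1)/2 \<notin> \<int>\<^sub>\<le>\<^sub>0
              \<and> (\<beta> + of_nat r + 1)/2 - of_nat i \<notin> \<int>\<^sub>\<le>\<^sub>0)
     \<longrightarrow>
     kdf [\<alpha>] [3/2*\<beta> - \<alpha>/2 - 1 - of_nat i]
        [(\<alpha> - \<beta>)/2 + 1 + of_nat i, 1 + \<alpha>/2, (\<alpha> - \<beta>)/2]
        [\<beta>] [] [\<alpha>/2, 1 + (\<alpha> + \<beta>)/2] (1/2) (1/2)
     = 2 powr (\<alpha> - 1) * Gamma (\<beta>/2 - \<alpha>/2 - of_nat i) * Gamma (1 + (\<alpha> + \<beta>)/2)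
       / (Gamma (\<beta>/2 - \<alpha>/2) * Gamma (1 + \<alpha>))
       * (\<Sum>r=0..i. (-1)^r * of_nat (i choose r)
            * Gamma ((\<alpha> + of_nat r + 1)/2) / Gamma ((\<beta> + of_nat r + 1)/2 - of_nat i)))
    \<and>
    (kdf_term [\<alpha>] [3/2*\<beta> - \<alpha>/2 - 1 + of_nat i]
        [(\<alpha> - \<beta>)/2 + 1 - of_nat i, 1 + \<alpha>/2, (\<alpha> - \<beta>)/2]
        [\<beta>] [] [\<alpha>/2, 1 + (\<alpha> + \<beta>)/2] (1/2) (1/2) summable_on UNIV
     \<and> 1 + \<alpha> \<notin> \<int>\<^sub>\<le>\<^sub>0
     \<and> (\<forall>r\<le>i. (\<alpha> + of_nat r + 1)/2 \<notin> \<int>\<^sub>\<le>\<^sub>0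
              \<and> (\<beta> + of_nat r + 1)/2 \<notin> \<int>\<^sub>\<le>\<^sub>0)
     \<longrightarrow>
     kdf [\<alpha>] [3/2*\<beta> - \<alpha>/2 - 1 + of_nat i]
        [(\<alpha> - \<beta>)/2 + 1 - of_nat i, 1 + \<alpha>/2, (\<alpha> - \<beta>)/2]
        [\<beta>] [] [\<alpha>/2, 1 + (\<alpha> + \<beta>)/2] (1/2) (1/2)
     = 2 powr (\<alpha> - 1) * Gamma (1 + (\<alpha> + \<beta>)/2) / Gamma (1 + \<alpha>)
       * (\<Sum>r=0..i. of_nat (i choose r)
            * Gamma ((\<alpha> + of_nat r + 1)/2) / Gamma ((\<beta> + of_nat r + 1)/2)))"
proof (intro conjI impI; elim conjE)
  define d where "d = 1 + (\<alpha> + \<beta>) / 2"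
  have shift: "1 + \<alpha> + of_nat r = \<alpha> + of_nat r + 1" "1 + \<alpha> - 1 = \<alpha>" for r
    by simp_all
  \<comment> \<open>The shifted Gauss theorems are used with \<open>a = 1 + \<alpha>\<close> and
    \<open>b = \<beta>\<close>, for which their denominator parameter \<open>(a + b + 1)/2\<close>
    is exactly \<open>d\<close>.\<close>
  have d_eq: "(1 + \<alpha> + \<beta> + 1) / 2 = d" by (simp add: d_def field_simps)
  {
    define \<gamma> where "\<gamma> = (\<alpha> - \<beta>)/2 + 1 + of_nat i"
    have \<gamma>: "3/2*\<beta> - \<alpha>/2 - 1 - of_nat i = \<beta> - \<gamma>" "d - \<gamma> = \<beta> - of_nat i"
      by (simp_all add: \<gamma>_def d_def field_simps)
    let ?e = "\<beta>/2 - \<alpha>/2"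
    assume s: "kdf_term [\<alpha>] [3/2*\<beta> - \<alpha>/2 - 1 - of_nat i]
        [(\<alpha> - \<beta>)/2 + 1 + of_nat i, 1 + \<alpha>/2, (\<alpha> - \<beta>)/2]
        [\<beta>] [] [\<alpha>/2, 1 + (\<alpha> + \<beta>)/2] (1/2) (1/2) summable_on UNIV"
      and e: "?e - of_nat i \<notin> \<int>\<^sub>\<le>\<^sub>0" "?e \<notin> \<int>\<^sub>\<le>\<^sub>0" and a: "1 + \<alpha> \<notin> \<int>\<^sub>\<le>\<^sub>0"
    define X where "X = (\<Sum>r=0..i. (-1)^r * of_nat (i choose r)
            * Gamma ((\<alpha> + of_nat r + 1)/2) / Gamma ((\<beta> + of_nat r + 1)/2 - of_nat i))"
    have "pochhammer (?e - of_nat i) i * reg_hyp (1 + \<alpha>) (\<beta> - of_nat i) d (1/2) = 2 powr \<alpha> * rGamma (1 + \<alpha>) * X"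
    proof -
      have "(\<beta> - (1 + \<alpha>) + 1) / 2 = ?e" by (simp add: field_simps)
      with Gauss_second_summation_denominator_shift[OF a, of \<beta> i] show ?thesis
        unfolding d_eq shift X_def rGamma_inverse_Gamma by (simp only: divide_inverse mult.assoc)
    qed
    \<comment> \<open>The Pochhammer prefactor of the denominator shift is a Gamma quotient, nonzero
      by the conditions on \<open>?e\<close>; its reciprocal is the extra quotient in the first
      formula.\<close>
    moreover have "pochhammer (?e - of_nat i) i = Gamma ?e / Gamma (?e - of_nat i)"
      using pochhammer_Gamma[OF e(1), of i] by simp
    ultimately have "reg_hyp (1 + \<alpha>) (\<beta> - of_nat i) d (1/2)
       = Gamma (?e - of_nat i) / Gamma ?e * (2 powr \<alpha> * rGamma (1 + \<alpha>) * X)"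
      using e by (simp add: Gamma_eq_zero_iff field_simps)
    moreover have "kdf [\<alpha>] [3/2*\<beta> - \<alpha>/2 - 1 - of_nat i]
        [(\<alpha> - \<beta>)/2 + 1 + of_nat i, 1 + \<alpha>/2, (\<alpha> - \<beta>)/2]
        [\<beta>] [] [\<alpha>/2, 1 + (\<alpha> + \<beta>)/2] (1/2) (1/2) = Gamma d / 2 * reg_hyp (1 + \<alpha>) (\<beta> - of_nat i) d (1/2)"
      using kdf_eq_reg_hyp[OF den, of \<gamma>] s unfolding \<gamma>(1) \<gamma>(2)[symmetric] \<gamma>_def[symmetric] d_def[symmetric]
      by blast
    \<comment> \<open>The factor \<open>1/2\<close> from the collapsed double series lowers the
      exponent from \<open>\<alpha>\<close> to \<open>\<alpha> - 1\<close>.\<close>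
    moreover have "(2 :: complex) powr \<alpha> = 2 powr (\<alpha> - 1) * 2"
      using powr_add[of 2 "\<alpha> - 1" 1] by simp
    ultimately show "kdf [\<alpha>] [3/2*\<beta> - \<alpha>/2 - 1 - of_nat i]
        [(\<alpha> - \<beta>)/2 + 1 + of_nat i, 1 + \<alpha>/2, (\<alpha> - \<beta>)/2]
        [\<beta>] [] [\<alpha>/2, 1 + (\<alpha> + \<beta>)/2] (1/2) (1/2)
     = 2 powr (\<alpha> - 1) * Gamma (\<beta>/2 - \<alpha>/2 - of_nat i) * Gamma (1 + (\<alpha> + \<beta>)/2)
       / (Gamma (\<beta>/2 - \<alpha>/2) * Gamma (1 + \<alpha>))
       * (\<Sum>r=0..i. (-1)^r * of_nat (i choose r)
            * Gamma ((\<alpha> + of_nat r + 1)/2) / Gamma ((\<beta> + of_nat r + 1)/2 - of_nat i))"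
      unfolding X_def[symmetric] d_def[symmetric] by (simp add: rGamma_inverse_Gamma field_simps)
  next
    define \<gamma> where "\<gamma> = (\<alpha> - \<beta>)/2 + 1 - of_nat i"
    have \<gamma>: "3/2*\<beta> - \<alpha>/2 - 1 + of_nat i = \<beta> - \<gamma>" "d - \<gamma> = \<beta> + of_nat i"
      by (simp_all add: \<gamma>_def d_def field_simps)
    assume s: "kdf_term [\<alpha>] [3/2*\<beta> - \<alpha>/2 - 1 + of_nat i]
        [(\<alpha> - \<beta>)/2 + 1 - of_nat i, 1 + \<alpha>/2, (\<alpha> - \<beta>)/2]
        [\<beta>] [] [\<alpha>/2, 1 + (\<alpha> + \<beta>)/2] (1/2) (1/2) summable_on UNIV"
      and a: "1 + \<alpha> \<notin> \<int>\<^sub>\<le>\<^sub>0"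
    define X where "X = (\<Sum>r=0..i. of_nat (i choose r)
            * Gamma ((\<alpha> + of_nat r + 1)/2) / Gamma ((\<beta> + of_nat r + 1)/2))"
    have "reg_hyp (1 + \<alpha>) (\<beta> + of_nat i) d (1/2) = 2 powr \<alpha> * rGamma (1 + \<alpha>) * X"
      using Gauss_second_summation_numerator_shift[OF a, of \<beta> i]
      unfolding d_eq shift X_def rGamma_inverse_Gamma by (simp only: divide_inverse mult.assoc)
    moreover have "kdf [\<alpha>] [3/2*\<beta> - \<alpha>/2 - 1 + of_nat i]
        [(\<alpha> - \<beta>)/2 + 1 - of_nat i, 1 + \<alpha>/2, (\<alpha> - \<beta>)/2]
        [\<beta>] [] [\<alpha>/2, 1 + (\<alpha> + \<beta>)/2] (1/2) (1/2) = Gamma d / 2 * reg_hyp (1 + \<alpha>) (\<beta> + of_nat i) d (1/2)"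
      using kdf_eq_reg_hyp[OF den, of \<gamma>] s unfolding \<gamma>(1) \<gamma>(2)[symmetric] \<gamma>_def[symmetric] d_def[symmetric]
      by blast
    moreover have "(2 :: complex) powr \<alpha> = 2 powr (\<alpha> - 1) * 2"
      using powr_add[of 2 "\<alpha> - 1" 1] by simp
    ultimately show "kdf [\<alpha>] [3/2*\<beta> - \<alpha>/2 - 1 + of_nat i]
        [(\<alpha> - \<beta>)/2 + 1 - of_nat i, 1 + \<alpha>/2, (\<alpha> - \<beta>)/2]
        [\<beta>] [] [\<alpha>/2, 1 + (\<alpha> + \<beta>)/2] (1/2) (1/2)
     = 2 powr (\<alpha> - 1) * Gamma (1 + (\<alpha> + \<beta>)/2) / Gamma (1 + \<alpha>)
       * (\<Sum>r=0..i. of_nat (i choose r)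
            * Gamma ((\<alpha> + of_nat r + 1)/2) / Gamma ((\<beta> + of_nat r + 1)/2))"
      unfolding X_def[symmetric] d_def[symmetric] by (simp add: rGamma_inverse_Gamma field_simps)
  }
qed

end
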